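(* Let $P_1,P_2,\ldots$ be p-values such that $P_i$ is $\mathcal{F}_i$-measurable and $\mathbb{P}(P_i\le x\mid\mathcal{F}_{i-1})\le x$ for all $\mathbb{P}\in\mathcal{P}$, $i\in I_0^{\mathbb{P}}$, $x\in[0,1]$, and let $\alpha_1,\alpha_2,\ldots$ be nonnegative thresholds with $\alpha_i$ being $\mathcal{F}_{i-1}$-measurable. Let $S_t=\{i\le t:P_i\le\alpha_i\}$, $t\in\mathbb{N}$. Then the \texttt{m-online-simple} procedure (the algorithm given in the context) and the \texttt{cu-online-simple} procedure uniformly improve the \texttt{u-online-simple} method.
   Context: Setting. $\mathbb{N}=\{1,2,\ldots\}$, $\alpha\in(0,1)$ is fixed, $\Omega$ is equipped with a filtration $(\mathcal{F}_i)_{i\in\mathbb{N}_0}$ with $\mathcal{F}_0=\{\emptyset,\Omega\}$, and $\mathcal{P}$ is a set of probability distributions. Null hypotheses are subsets $H_1,H_2,\ldots\subseteq\mathcal{P}$. For $\mathbb{P}\in\mathcal{P}$: $I_0^{\mathbb{P}}=\{i\in\mathbb{N}:\mathbb{P}\in H_i\}$, $I_1^{\mathbb{P}}=\mathbb{N}\setminus I_0^{\mathbb{P}}$. For a family $\boldsymbol{\phi}=(\phi_I)_{I\subseteq\mathbb{N}}$ of $\{0,1\}$-valued tests, the closed procedure is $\boldsymbol{d}^{\boldsymbol{\phi}}(S)=\inf\{|S\setminus I|: I\subseteq\mathbb{N},\ \phi_I=0\}$ for finite $S\subseteq\mathbb{N}$. For $a\in\mathbb{N}$ let $\alpha(a)=\frac{6\alpha}{a^2\pi^2}$,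 $c_a=\frac{\log(1/\alpha(a))}{a\log(1+\log(1/\alpha(a))/a)}$, $\theta_{c_a}=\log(1/\alpha(a))/(c_aa)$. \texttt{u-online-simple}: $\boldsymbol{d}^{\mathrm{u\text{-}os}}(S_t)=\max_{a\in\mathbb{N}}\boldsymbol{d}_a^{\mathrm{os}}(S_t)$, where $\boldsymbol{d}_a^{\mathrm{os}}(S_t)=\lceil -c_aa+\sum_{i=1}^t(\mathbb{1}\{P_i\le\alpha_i\}-c_a\alpha_i)\rceil$. Let $E_i^{\mathrm{os},a}=\exp[\theta_{c_a}(\mathbb{1}\{P_i\le\alpha_i\}-c_a\alpha_i)]$ and $W_I^{t,a}=\prod_{i\in I\cap\{1,\ldots,t\}}E_i^{\mathrm{os},a}$. \texttt{cu-online-simple} (closed u-online-simple): $\boldsymbol{d}^{\mathrm{cu\text{-}os}}(S_t)=\max_{a\in\mathbb{N}}\boldsymbol{d}^{\boldsymbol{\phi}^a}(S_t)$ with $\boldsymbol\phi^a=(\phi^a_I)_{I\subseteq\mathbb N}$, $\phi_I^a=\mathbb{1}\{\exists t\in I: W_I^{t,a}\ge1/\alpha(a)\}$. \texttt{m-online-simple}: the closed procedure $\boldsymbol{d}^{\mathrm{m\text{-}os}}=\boldsymbol{d}^{\boldsymbol{\phi}^{\mathrm{m\text{-}os}}}$ with $\phi_I^{\mathrm{m\text{-}os}}=\mathbb{1}\{\exists t\in I:\sum_{a\in\mathbb{N}}\frac{6}{a^2\pi^2}W_I^{t,a}\ge1/\alpha\}$, whose bounds $d_t$ for $S_t$ are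 computed by the following short-cut algorithm. Initialize $d_0=0$, $S_0=\emptyset$, $A_0^c=\emptyset$. For $t=1,2,\ldots$: set $S_t=S_{t-1}\cup\{t\}$ if $P_t\le\alpha_t$ and $S_t=S_{t-1}$ otherwise; if $\sum_{a\in\mathbb{N}}\frac{6}{a^2\pi^2}\prod_{i\in\{1,\ldots,t\}\setminus A_{t-1}^c}E_i^{\mathrm{os},a}\ge1/\alpha$, set $d_t=d_{t-1}+1$ and $A_t^c=A_{t-1}^c\cup\{\text{index of the smallest }\alpha_i\text{ with } i\in S_t\setminus A_{t-1}^c\}$; otherwise set $d_t=d_{t-1}$ and $A_t^c=A_{t-1}^c$. Output $S_t,d_t$. Uniform improvement. A procedure with simultaneous true discovery guarantee is a random function $\boldsymbol d$ from the finite subsets of $\mathbb{N}$ to $\mathbb{N}\cup\{0\}$ with $\mathbb{P}(\boldsymbol d(S)\le|S\cap I_1^{\mathbb{P}}|\text{ for all finite }S)\ge1-\alpha$ for all $\mathbb{P}\in\mathcal{P}$. A procedure $\tilde{\boldsymbol d}$ uniformly improves $\boldsymbol d$ if $\tilde{\boldsymbol d}(S)\ge\boldsymbol d(S)$ for all $S$ and $\mathbb{P}(\tilde{\boldsymbol d}(S)>\boldsymbol d(S))>0$ for at least one $\mathbb{P}\in\mathcal{P}$ and at least one $S$. For procedures reporting bounds only along a query path $(S_t)_{t\in\mathbb{N}}$, this is read along the path: the guarantee is $\mathbb{P}(d_t\le|S_t\cap I_1^{\mathbb{P}}|\text{ for all }t)\ge1-\alpha$ for all $\mathbb{P}\in\mathcal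 P$, and $(\tilde d_t)$ uniformly improves $(d_t)$ if $\tilde d_t\ge d_t$ for all $t$ and $\mathbb{P}(\tilde d_t>d_t)>0$ for at least one $\mathbb{P}\in\mathcal{P}$ and at least one $t$.
   Formalization: The strict part of "uniformly improve" (positive probability of a larger bound for some distribution and t) is claimed only when the null hypothesis H_1 is nonempty, since it can fail for empty H_1; the guarantee and the domination hold without this condition. *)

theory Defs
  imports "HOL-Probability.Probability"
begin

definition level :: "real \<Rightarrow> nat \<Rightarrow> real" where
  "level \<alpha> a = 6 * \<alpha> / (real a ^ 2 * pi ^ 2)"

definition c_const :: "real \<Rightarrow> nat \<Rightarrow> real" where
  "c_const \<alpha> a = ln (1 / level \<alpha> a) / (real a * ln (1 + ln (1 / level \<alpha> a) / real a))"

definition theta :: "real \<Rightarrow> nat \<Rightarrow> real" where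
  "theta \<alpha> a = ln (1 / level \<alpha> a) / (c_const \<alpha> a * real a)"

text \<open>In all definitions below, \<open>P i \<omega>\<close> is the \<open>i\<close>-th p-value and \<open>thr i \<omega>\<close> the \<open>i\<close>-th threshold
  at the outcome \<open>\<omega>\<close>. Hypotheses, times and the parameter \<open>a\<close> are numbered from 1, so index sets
  are subsets of \<open>{1..}\<close>; values of \<open>P\<close> and \<open>thr\<close> at 0 are never used.\<close>

definition rejected :: "(nat \<Rightarrow> 'w \<Rightarrow> real) \<Rightarrow> (nat \<Rightarrow> 'w \<Rightarrow> real) \<Rightarrow> nat \<Rightarrow> 'w \<Rightarrow> nat set" where
  "rejected P thr t \<omega> = {i \<in> {1..t}. P i \<omega> \<le> thr i \<omega>}"

text \<open>The bound for a single \<open>a\<close> may be negative; it is not truncated at 0. The supremum over \<open>a\<close> is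
  attained, since the bounds are integers bounded above by \<open>t\<close>.\<close>

definition os_bound ::
  "real \<Rightarrow> (nat \<Rightarrow> 'w \<Rightarrow> real) \<Rightarrow> (nat \<Rightarrow> 'w \<Rightarrow> real) \<Rightarrow> nat \<Rightarrow> nat \<Rightarrow> 'w \<Rightarrow> int" where
  "os_bound \<alpha> P thr a t \<omega> =
     \<lceil>- c_const \<alpha> a * real a
        + (\<Sum>i=1..t. of_bool (P i \<omega> \<le> thr i \<omega>) - c_const \<alpha> a * thr i \<omega>)\<rceil>"

definition u_online_simple ::
  "real \<Rightarrow> (nat \<Rightarrow> 'w \<Rightarrow> real) \<Rightarrow> (nat \<Rightarrow> 'w \<Rightarrow> real) \<Rightarrow> nat \<Rightarrow> 'w \<Rightarrow> int" where
  "u_online_simple \<alpha> P thr t \<omega> = (SUP a\<in>{1..}. os_bound \<alpha> P thr a t \<omega>)"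

definition E_os ::
  "real \<Rightarrow> (nat \<Rightarrow> 'w \<Rightarrow> real) \<Rightarrow> (nat \<Rightarrow> 'w \<Rightarrow> real) \<Rightarrow> nat \<Rightarrow> nat \<Rightarrow> 'w \<Rightarrow> real" where
  "E_os \<alpha> P thr a i \<omega> =
     exp (theta \<alpha> a * (of_bool (P i \<omega> \<le> thr i \<omega>) - c_const \<alpha> a * thr i \<omega>))"

definition wealth ::
  "real \<Rightarrow> (nat \<Rightarrow> 'w \<Rightarrow> real) \<Rightarrow> (nat \<Rightarrow> 'w \<Rightarrow> real) \<Rightarrow> nat \<Rightarrow> nat set \<Rightarrow> nat \<Rightarrow> 'w \<Rightarrow> real" where
  "wealth \<alpha> P thr a I t \<omega> = (\<Prod>i\<in>I \<inter> {1..t}. E_os \<alpha> P thr a i \<omega>)"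

definition closed_bound :: "(nat set \<Rightarrow> nat) \<Rightarrow> nat set \<Rightarrow> nat" where
  "closed_bound \<phi> S = Inf {card (S - I) | I. I \<subseteq> {1..} \<and> \<phi> I = 0}"

definition test_os ::
  "real \<Rightarrow> (nat \<Rightarrow> 'w \<Rightarrow> real) \<Rightarrow> (nat \<Rightarrow> 'w \<Rightarrow> real) \<Rightarrow> nat \<Rightarrow> 'w \<Rightarrow> nat set \<Rightarrow> nat" where
  "test_os \<alpha> P thr a \<omega> I = of_bool (\<exists>t\<in>I. wealth \<alpha> P thr a I t \<omega> \<ge> 1 / level \<alpha> a)"

text \<open>The supremum is attained, since every closed bound is at most the cardinality of the
  rejection set.\<close>

definition cu_online_simple ::
  "real \<Rightarrow> (nat \<Rightarrow> 'w \<Rightarrow> real) \<Rightarrow> (nat \<Rightarrow> 'w \<Rightarrow> real) \<Rightarrow> nat \<Rightarrow> 'w \<Rightarrow> nat" where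
  "cu_online_simple \<alpha> P thr t \<omega> =
     (SUP a\<in>{1..}. closed_bound (test_os \<alpha> P thr a \<omega>) (rejected P thr t \<omega>))"

text \<open>Index of the smallest threshold in \<open>B\<close>. Ties are broken towards the smaller index; the
  bounds do not depend on this choice, because for rejected \<open>i\<close> the factor \<^const>\<open>E_os\<close> depends on
  \<open>i\<close> only through the threshold.\<close>

definition smallest_thr_index :: "(nat \<Rightarrow> 'w \<Rightarrow> real) \<Rightarrow> nat set \<Rightarrow> 'w \<Rightarrow> nat" where
  "smallest_thr_index thr B \<omega> = (LEAST i. i \<in> B \<and> (\<forall>j\<in>B. thr i \<omega> \<le> thr j \<omega>))"

text \<open>State after step \<open>t\<close>: the current bound and the set of excluded indices. Whenever the
  update condition holds, the set of rejected indices that are not yet excluded is nonempty.\<close>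

primrec m_os_state ::
  "real \<Rightarrow> (nat \<Rightarrow> 'w \<Rightarrow> real) \<Rightarrow> (nat \<Rightarrow> 'w \<Rightarrow> real) \<Rightarrow> nat \<Rightarrow> 'w \<Rightarrow> nat \<times> nat set" where
  "m_os_state \<alpha> P thr 0 \<omega> = (0, {})"
| "m_os_state \<alpha> P thr (Suc t) \<omega> =
     (let (d, Ac) = m_os_state \<alpha> P thr t \<omega> in
      if (\<Sum>\<^sub>\<infinity>a\<in>{1..}. 6 / (real a ^ 2 * pi ^ 2) * (\<Prod>i\<in>{1..Suc t} - Ac. E_os \<alpha> P thr a i \<omega>))
           \<ge> 1 / \<alpha>
      then (d + 1, Ac \<union> {smallest_thr_index thr (rejected P thr (Suc t) \<omega> - Ac) \<omega>})
      else (d, Ac))"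

definition m_online_simple ::
  "real \<Rightarrow> (nat \<Rightarrow> 'w \<Rightarrow> real) \<Rightarrow> (nat \<Rightarrow> 'w \<Rightarrow> real) \<Rightarrow> nat \<Rightarrow> 'w \<Rightarrow> nat" where
  "m_online_simple \<alpha> P thr t \<omega> = fst (m_os_state \<alpha> P thr t \<omega>)"

definition non_nulls :: "(nat \<Rightarrow> 'w measure set) \<Rightarrow> 'w measure \<Rightarrow> nat set" where
  "non_nulls H M = {1..} - {i \<in> {1..}. M \<in> H i}"

text \<open>\<^const>\<open>measure\<close> is 0 on non-measurable sets, so a lower bound on it includes measurability
  of the event.\<close>

definition true_discovery_guarantee ::
  "real \<Rightarrow> 'w measure set \<Rightarrow> (nat \<Rightarrow> 'w measure set) \<Rightarrow> (nat \<Rightarrow> 'w \<Rightarrow> nat set)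
    \<Rightarrow> (nat \<Rightarrow> 'w \<Rightarrow> int) \<Rightarrow> bool" where
  "true_discovery_guarantee \<alpha> \<P> H S d \<longleftrightarrow>
     (\<forall>M\<in>\<P>. measure M {\<omega> \<in> space M. \<forall>t\<ge>1. d t \<omega> \<le> int (card (S t \<omega> \<inter> non_nulls H M))} \<ge> 1 - \<alpha>)"

definition dominates :: "'w set \<Rightarrow> (nat \<Rightarrow> 'w \<Rightarrow> int) \<Rightarrow> (nat \<Rightarrow> 'w \<Rightarrow> int) \<Rightarrow> bool" where
  "dominates \<Omega> d' d \<longleftrightarrow> (\<forall>t\<ge>1. \<forall>\<omega>\<in>\<Omega>. d' t \<omega> \<ge> d t \<omega>)"

definition uniformly_improves ::
  "'w set \<Rightarrow> 'w measure set \<Rightarrow> (nat \<Rightarrow> 'w \<Rightarrow> int) \<Rightarrow> (nat \<Rightarrow> 'w \<Rightarrow> int) \<Rightarrow> bool" where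
  "uniformly_improves \<Omega> \<P> d' d \<longleftrightarrow>
     dominates \<Omega> d' d \<and> (\<exists>M\<in>\<P>. \<exists>t\<ge>1. measure M {\<omega> \<in> space M. d' t \<omega> > d t \<omega>} > 0)"

end

theory Submission
  imports Defs
begin

text \<open>
  A closed procedure discards any index set \<open>I\<close> whose accumulated wealth is large. If the wealth
  on \<open>I\<close> up to time \<open>t\<close> is below \<open>1 / level \<alpha> a\<close>, taking logarithms bounds the sum of
  \<open>1{P\<^sub>i \<le> \<alpha>\<^sub>i} - c\<^sub>a \<alpha>\<^sub>i\<close> over \<open>I\<close> by \<open>c\<^sub>a a\<close>, and the remaining indices contribute at most one per
  rejection outside \<open>I\<close>; this is the u-online-simple bound. For the short-cut, \<open>I\<close> is the
  complement of the exclusions, on which the mixture stays below \<open>1 / \<alpha>\<close>: an update can only happen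
  at a rejection, and the excluded factor is at least as large as the new one.

  For the guarantees let \<open>I\<close> be the set of true nulls. The mixture over \<open>I\<close> is a nonnegative
  supermartingale started at 1, so by Ville's inequality it stays below \<open>1 / \<alpha>\<close> with probability
  at least \<open>1 - \<alpha>\<close>. On that event every single-\<open>a\<close> wealth stays below \<open>1 / level \<alpha> a\<close>, and the
  short-cut never exceeds the number of rejections outside \<open>I\<close> because its greedy choice of
  exclusions has the smallest possible sum of thresholds. The improvement is strict already at time
  1, where the u-online-simple bound is negative unless \<open>P\<^sub>1 \<le> \<alpha>\<^sub>1 < 1\<close>.
\<close>

subsection \<open>Constants\<close>

definition weight :: "nat \<Rightarrow> real" where
  "weight a = 6 / (real a ^ 2 * pi ^ 2)"

text \<open>A free index set \<open>B\<close> covers both the test statistic over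
  \<open>I \<inter> {1..t}\<close> and the update statistic of the short-cut over the indices not
  excluded.\<close>

definition mixture ::
  "real \<Rightarrow> (nat \<Rightarrow> 'w \<Rightarrow> real) \<Rightarrow> (nat \<Rightarrow> 'w \<Rightarrow> real) \<Rightarrow> nat set \<Rightarrow> 'w \<Rightarrow> real" where
  "mixture \<alpha> P thr B \<omega> = (\<Sum>\<^sub>\<infinity>a\<in>{1..}. weight a * (\<Prod>i\<in>B. E_os \<alpha> P thr a i \<omega>))"

lemma weight_pos: "a \<ge> 1 \<Longrightarrow> 0 < weight a"
  by (simp add: weight_def)

lemma weight_nonneg: "0 \<le> weight a"
  by (simp add: weight_def)

lemma level_eq_weight: "level \<alpha> a = \<alpha> * weight a"
  by (simp add: level_def weight_def)

text \<open>The Basel series, shifted by one: the weights form a probability distribution on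
  \<open>{1..}\<close>, so an empty product gives mixture 1.\<close>

lemma weight_has_sum: "(weight has_sum 1) {1..}"
proof -
  have "(\<lambda>n. (6 / pi\<^sup>2) * (1 / (real n + 1)\<^sup>2)) sums ((6 / pi\<^sup>2) * (pi\<^sup>2 / 6))"
    using sums_mult[OF inverse_squares_sums, of "6 / pi\<^sup>2"] by (simp add: add.commute)
  moreover have "(6 / pi\<^sup>2) * (1 / (real n + 1)\<^sup>2) = weight (Suc n)" for n
    by (simp add: weight_def add.commute)
  ultimately have "(\<lambda>n. weight (Suc n)) sums 1"
    by simp
  then have "((\<lambda>n. weight (Suc n)) has_sum 1) UNIV"
    by (intro sums_nonneg_imp_has_sum) (simp_all add: weight_nonneg)
  then have "(weight has_sum 1) (Suc ` UNIV)"
    by (subst has_sum_reindex) (simp_all add: o_def)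
  moreover have "Suc ` UNIV = {1..}"
    by (auto simp: image_iff Suc_le_eq gr0_conv_Suc)
  ultimately show ?thesis by simp
qed

text \<open>By \<open>pi > 3\<close> every level is strictly below 1; positivity of the other
  constants rests on this.\<close>

lemma ln_inverse_level_pos:
  assumes "0 < \<alpha>" "\<alpha> < 1" "a \<ge> 1"
  shows "0 < ln (1 / level \<alpha> a)"
proof -
  have "6 < pi\<^sup>2"
    using power_strict_mono[OF pi_gt3, of 2] by simp
  also have "pi\<^sup>2 \<le> (real a)\<^sup>2 * pi\<^sup>2"
    using assms(3) mult_right_mono[of 1 "(real a)\<^sup>2" "pi\<^sup>2"] by simp
  finally have "6 * \<alpha> < (real a)\<^sup>2 * pi\<^sup>2"
    using assms by linarith
  moreover have "0 < (real a)\<^sup>2 * pi\<^sup>2"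
    using assms by simp
  ultimately have "level \<alpha> a < 1" "0 < level \<alpha> a"
    using assms unfolding level_def by (simp_all add: divide_simps)
  then show ?thesis by simp
qed

lemma theta_eq:
  assumes "0 < \<alpha>" "\<alpha> < 1" "a \<ge> 1"
  shows "theta \<alpha> a = ln (1 + ln (1 / level \<alpha> a) / real a)"
  using ln_inverse_level_pos[OF assms] assms(3)
  by (simp add: theta_def c_const_def field_simps)

lemma theta_pos:
  assumes "0 < \<alpha>" "\<alpha> < 1" "a \<ge> 1"
  shows "0 < theta \<alpha> a"
  using divide_pos_pos[OF ln_inverse_level_pos[OF assms], of "real a"] assms(3)
  by (simp add: theta_eq[OF assms] ln_gt_zero)

text \<open>The product \<open>theta \<alpha> a * c_const \<alpha> a\<close> is also
  \<open>ln (1 / level \<alpha> a) / a\<close>, so \<open>exp (theta \<alpha> a) - 1\<close> equals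
  it. This calibration makes \<open>E_os\<close> an e-variable.\<close>

lemma exp_theta:
  assumes "0 < \<alpha>" "\<alpha> < 1" "a \<ge> 1"
  shows "exp (theta \<alpha> a) = 1 + ln (1 / level \<alpha> a) / real a"
proof -
  have "0 < ln (1 / level \<alpha> a) / real a"
    using ln_inverse_level_pos[OF assms] assms(3) by simp
  then show ?thesis
    unfolding theta_eq[OF assms] by (subst exp_ln) simp_all
qed

text \<open>The constant has the form \<open>y / ln (1 + y)\<close> with \<open>y > 0\<close>, and
  \<open>ln (1 + y) < y\<close>.\<close>

lemma c_const_gt_1:
  assumes "0 < \<alpha>" "\<alpha> < 1" "a \<ge> 1"
  shows "1 < c_const \<alpha> a"
proof -
  define y where "y = ln (1 / level \<alpha> a) / real a"
  have y: "0 < y"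
    using ln_inverse_level_pos[OF assms] assms(3) by (simp add: y_def)
  then have "ln (1 + y) < y" "0 < ln (1 + y)"
    by (auto intro: ln_add_one_self_less_self)
  moreover have "c_const \<alpha> a = y / ln (1 + y)"
    by (simp add: c_const_def y_def)
  ultimately show ?thesis by simp
qed

text \<open>Taking logarithms and dividing by \<open>theta\<close> turns the wealth threshold
  \<open>1 / level \<alpha> a\<close> into the offset \<open>c_const \<alpha> a * a\<close> of
  \<open>os_bound\<close>.\<close>

lemma theta_c_const:
  assumes "0 < \<alpha>" "\<alpha> < 1" "a \<ge> 1"
  shows "theta \<alpha> a * (c_const \<alpha> a * real a) = ln (1 / level \<alpha> a)"
  using c_const_gt_1[OF assms] assms(3) by (simp add: theta_def)

text \<open>The rate \<open>ln (1 / level \<alpha> a) / a\<close> stays bounded in \<open>a\<close>, which makes the mixture summable.\<close>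

lemma exp_theta_le:
  assumes "0 < \<alpha>" "\<alpha> < 1" "a \<ge> 1"
  shows "exp (theta \<alpha> a) \<le> 3 + ln (1 / level \<alpha> 1)"
proof -
  have "1 / level \<alpha> a = (real a)\<^sup>2 * (1 / level \<alpha> 1)"
    by (simp add: level_def)
  moreover have "0 < 1 / level \<alpha> 1" "0 < (real a)\<^sup>2"
    using assms by (simp_all add: level_def)
  ultimately have "ln (1 / level \<alpha> a) = 2 * ln (real a) + ln (1 / level \<alpha> 1)"
    using assms by (simp only: ln_mult_pos ln_realpow)
  also have "\<dots> \<le> 2 * real a + ln (1 / level \<alpha> 1) * real a"
  proof (intro add_mono)
    show "2 * ln (real a) \<le> 2 * real a"
      using ln_le_minus_one[of "real a"] assms(3) by simp
    show "ln (1 / level \<alpha> 1) \<le> ln (1 / level \<alpha> 1) * real a"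
      using ln_inverse_level_pos[OF assms(1,2), of 1] assms(3)
        mult_left_mono[of 1 "real a" "ln (1 / level \<alpha> 1)"] by simp
  qed
  finally have "ln (1 / level \<alpha> a) / real a \<le> 2 + ln (1 / level \<alpha> 1)"
    using assms(3) by (simp add: field_simps)
  then show ?thesis by (simp add: exp_theta[OF assms])
qed

section \<open>Rejection sets and the greedy index\<close>

lemma rejected_subset: "rejected P thr t \<omega> \<subseteq> {1..t}"
  by (auto simp: rejected_def)

lemma finite_rejected [simp]: "finite (rejected P thr t \<omega>)"
  by (rule finite_subset[OF rejected_subset]) simp

lemma mem_rejected: "i \<in> rejected P thr t \<omega> \<longleftrightarrow> 1 \<le> i \<and> i \<le> t \<and> P i \<omega> \<le> thr i \<omega>"
  by (auto simp: rejected_def)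

lemma rejected_Suc:
  "rejected P thr (Suc t) \<omega> =
     (if P (Suc t) \<omega> \<le> thr (Suc t) \<omega> then insert (Suc t) (rejected P thr t \<omega>)
      else rejected P thr t \<omega>)"
  by (auto simp: mem_rejected le_Suc_eq)

lemma smallest_thr_index_works:
  assumes "finite B" "B \<noteq> {}"
  shows "smallest_thr_index thr B \<omega> \<in> B"
    and "j \<in> B \<Longrightarrow> thr (smallest_thr_index thr B \<omega>) \<omega> \<le> thr j \<omega>"
proof -
  obtain i where "i \<in> B" "\<And>j. j \<in> B \<Longrightarrow> thr i \<omega> \<le> thr j \<omega>"
    using arg_min_if_finite[OF assms, of "\<lambda>i. thr i \<omega>"] arg_min_least[OF assms] by metis
  then have "\<exists>i. i \<in> B \<and> (\<forall>j\<in>B. thr i \<omega> \<le> thr j \<omega>)" by blast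
  from LeastI_ex[OF this]
  show "smallest_thr_index thr B \<omega> \<in> B"
    and "j \<in> B \<Longrightarrow> thr (smallest_thr_index thr B \<omega>) \<omega> \<le> thr j \<omega>"
    unfolding smallest_thr_index_def by blast+
qed

subsection \<open>Deterministic bounds along a path\<close>

text \<open>One outcome \<open>\<omega>\<close> is fixed, so the comparison of the procedures is
  deterministic; no distribution or measurability enters.\<close>

locale online_path =
  fixes \<alpha> :: real and P thr :: "nat \<Rightarrow> 'w \<Rightarrow> real" and \<omega> :: 'w
  assumes \<alpha>: "0 < \<alpha>" "\<alpha> < 1"
    and thr_nonneg: "i \<ge> 1 \<Longrightarrow> 0 \<le> thr i \<omega>"
begin

abbreviation "c \<equiv> c_const \<alpha>"
abbreviation "\<theta> \<equiv> theta \<alpha>"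
abbreviation "rej t \<equiv> rejected P thr t \<omega>"
abbreviation "mix B \<equiv> mixture \<alpha> P thr B \<omega>"

text \<open>The exponent of \<open>E_os\<close> without the factor \<open>theta\<close>. That factor
  is positive, so comparing wealth amounts to comparing sums of gains.\<close>

definition gain :: "nat \<Rightarrow> nat \<Rightarrow> real" where
  "gain a i = of_bool (P i \<omega> \<le> thr i \<omega>) - c a * thr i \<omega>"

lemma prod_E_os: "finite B \<Longrightarrow> (\<Prod>i\<in>B. E_os \<alpha> P thr a i \<omega>) = exp (\<theta> a * (\<Sum>i\<in>B. gain a i))"
  by (simp add: E_os_def gain_def sum_distrib_left exp_sum)

lemma gain_le_1:
  assumes "a \<ge> 1" "i \<ge> 1"
  shows "gain a i \<le> 1"
proof -
  have "0 \<le> c a * thr i \<omega>"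
    using c_const_gt_1[OF \<alpha> assms(1)] thr_nonneg[OF assms(2)] by simp
  then show ?thesis by (simp add: gain_def)
qed

lemma gain_nonrejected: "a \<ge> 1 \<Longrightarrow> i \<ge> 1 \<Longrightarrow> \<not> P i \<omega> \<le> thr i \<omega> \<Longrightarrow> gain a i \<le> 0"
  using c_const_gt_1[OF \<alpha>, of a] thr_nonneg[of i] by (simp add: gain_def)

lemma gain_rejected: "P i \<omega> \<le> thr i \<omega> \<Longrightarrow> gain a i = 1 - c a * thr i \<omega>"
  by (simp add: gain_def)

lemma sum_gain_le_card_rejected:
  assumes "a \<ge> 1" "B \<subseteq> {1..t}"
  shows "(\<Sum>i\<in>B. gain a i) \<le> card (rej t \<inter> B)"
proof -
  have "(\<Sum>i\<in>B. gain a i) \<le> (\<Sum>i\<in>B. of_bool (i \<in> rej t))"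
    using assms gain_le_1 gain_nonrejected
    by (intro sum_mono) (force simp: mem_rejected)
  also have "\<dots> = card (rej t \<inter> B)"
    using assms by (simp add: finite_subset Int_commute of_bool_def sum.If_cases)
  finally show ?thesis .
qed

text \<open>\<open>infsum\<close> defaults to 0 without summability, so this gives the mixture its
  meaning. Every factor is at most \<open>exp (theta \<alpha> a)\<close>, which is bounded by
  \<open>?K\<close> uniformly in \<open>a\<close>.\<close>

lemma mix_summable:
  assumes "finite B" "B \<subseteq> {1..}"
  shows "(\<lambda>a. weight a * (\<Prod>i\<in>B. E_os \<alpha> P thr a i \<omega>)) summable_on {1..}"
proof (rule summable_on_comparison_test)
  let ?K = "3 + ln (1 / level \<alpha> 1)"
  show "(\<lambda>a. weight a * ?K ^ card B) summable_on {1..}"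
    using weight_has_sum by (intro summable_on_cmult_left) (auto simp: summable_on_def)
  fix a :: nat assume a: "a \<in> {1..}"
  have "E_os \<alpha> P thr a i \<omega> \<le> ?K" if "i \<in> B" for i
  proof -
    have "E_os \<alpha> P thr a i \<omega> \<le> exp (\<theta> a)"
      using gain_le_1[of a i] theta_pos[OF \<alpha>, of a] a that assms
      by (auto simp: E_os_def gain_def[symmetric])
    also have "\<dots> \<le> ?K" using exp_theta_le[OF \<alpha>] a by simp
    finally show ?thesis .
  qed
  then have "(\<Prod>i\<in>B. E_os \<alpha> P thr a i \<omega>) \<le> (\<Prod>i\<in>B. ?K)"
    by (intro prod_mono) (auto simp: E_os_def)
  then show "weight a * (\<Prod>i\<in>B. E_os \<alpha> P thr a i \<omega>) \<le> weight a * ?K ^ card B"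
    by (intro mult_left_mono) (simp_all add: weight_nonneg)
  show "0 \<le> weight a * (\<Prod>i\<in>B. E_os \<alpha> P thr a i \<omega>)"
    by (simp add: weight_nonneg prod_nonneg E_os_def)
qed

text \<open>The comparison is made for each \<open>a\<close> separately. The two sets need be
  neither nested nor of equal size, which permits the exchange arguments for the short-cut.\<close>

lemma mix_mono:
  assumes "finite B" "B \<subseteq> {1..}" "finite B'" "B' \<subseteq> {1..}"
    and "\<And>a. a \<ge> 1 \<Longrightarrow> (\<Sum>i\<in>B. gain a i) \<le> (\<Sum>i\<in>B'. gain a i)"
  shows "mix B \<le> mix B'"
  unfolding mixture_def
proof (rule infsum_mono)
  fix a :: nat assume a: "a \<in> {1..}"
  have "\<theta> a * (\<Sum>i\<in>B. gain a i) \<le> \<theta> a * (\<Sum>i\<in>B'. gain a i)"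
    using assms(5) a theta_pos[OF \<alpha>, of a] by (intro mult_left_mono) auto
  then show "weight a * (\<Prod>i\<in>B. E_os \<alpha> P thr a i \<omega>) \<le> weight a * (\<Prod>i\<in>B'. E_os \<alpha> P thr a i \<omega>)"
    using assms by (intro mult_left_mono) (auto simp: prod_E_os weight_nonneg)
qed (use assms mix_summable in auto)

lemma mix_empty: "mix {} = 1"
  using weight_has_sum by (simp add: mixture_def infsumI)

lemma component_le_mix:
  assumes "finite B" "B \<subseteq> {1..}" "a \<ge> 1"
  shows "weight a * (\<Prod>i\<in>B. E_os \<alpha> P thr a i \<omega>) \<le> mix B"
  using finite_sum_le_infsum[OF mix_summable[OF assms(1,2)], of "{a}"] assms(3)
  by (simp add: mixture_def weight_nonneg prod_nonneg E_os_def)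

text \<open>A single term is at most the whole nonnegative sum, and \<open>level \<alpha> a\<close>
  is \<open>\<alpha>\<close> times the weight. Hence a small mixture controls all tests
  \<open>a\<close> at once.\<close>

lemma prod_E_os_less_of_mix_less:
  assumes "finite B" "B \<subseteq> {1..}" "a \<ge> 1" "mix B < 1 / \<alpha>"
  shows "(\<Prod>i\<in>B. E_os \<alpha> P thr a i \<omega>) < 1 / level \<alpha> a"
proof -
  have "weight a * (\<Prod>i\<in>B. E_os \<alpha> P thr a i \<omega>) < 1 / \<alpha>"
    using component_le_mix[OF assms(1-3)] assms(4) by linarith
  then show ?thesis
    using weight_pos[OF assms(3)] \<alpha> by (simp add: level_eq_weight field_simps)
qed

lemma sum_gain_less:
  assumes "finite B" "a \<ge> 1" "(\<Prod>i\<in>B. E_os \<alpha> P thr a i \<omega>) < 1 / level \<alpha> a"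
  shows "(\<Sum>i\<in>B. gain a i) < c a * real a"
proof -
  have lev: "0 < level \<alpha> a"
    using \<alpha> weight_pos[OF assms(2)] by (simp add: level_eq_weight)
  have "exp (\<theta> a * (\<Sum>i\<in>B. gain a i)) < exp (\<theta> a * (c a * real a))"
    using assms lev by (simp add: prod_E_os theta_c_const[OF \<alpha> assms(2)])
  then show ?thesis using theta_pos[OF \<alpha> assms(2)] by simp
qed

text \<open>Here \<open>B\<close> is the complement of a candidate set of nulls. Small wealth off
  \<open>B\<close> costs less than the subtracted offset, and \<open>B\<close> contributes at most
  its rejections. The right side is an integer, so the ceiling is harmless.\<close>

lemma os_bound_le:
  assumes "a \<ge> 1" "B \<subseteq> {1..t}" "(\<Prod>i\<in>{1..t} - B. E_os \<alpha> P thr a i \<omega>) < 1 / level \<alpha> a"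
  shows "os_bound \<alpha> P thr a t \<omega> \<le> int (card (rej t \<inter> B))"
proof -
  have "(\<Sum>i=1..t. gain a i) = (\<Sum>i\<in>{1..t} - B. gain a i) + (\<Sum>i\<in>B. gain a i)"
    using assms(2) by (simp add: sum.subset_diff)
  also have "\<dots> \<le> c a * real a + card (rej t \<inter> B)"
    using sum_gain_less[OF _ assms(1,3)] sum_gain_le_card_rejected[OF assms(1,2)] by simp
  finally show ?thesis
    by (simp add: os_bound_def gain_def ceiling_le_iff)
qed

lemma os_bound_le_t: "a \<ge> 1 \<Longrightarrow> os_bound \<alpha> P thr a t \<omega> \<le> int t"
proof -
  assume a: "a \<ge> 1"
  \<comment> \<open>With \<open>B = {1..t}\<close> the remaining product is empty, and
    \<open>1 < 1 / level \<alpha> a\<close>.\<close>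
  have "os_bound \<alpha> P thr a t \<omega> \<le> int (card (rej t \<inter> {1..t}))"
    using ln_inverse_level_pos[OF \<alpha> a] \<alpha> weight_pos[OF a]
    by (intro os_bound_le a) (simp_all add: level_eq_weight)
  also have "\<dots> \<le> int (card {1..t})"
    by (intro of_nat_mono card_mono) auto
  finally show ?thesis by simp
qed

text \<open>The integers are only conditionally complete; the bound \<open>t\<close>, uniform in
  \<open>a\<close>, makes the supremum meaningful.\<close>

lemma u_online_simple_le_iff:
  "u_online_simple \<alpha> P thr t \<omega> \<le> k \<longleftrightarrow> (\<forall>a\<ge>1. os_bound \<alpha> P thr a t \<omega> \<le> k)"
  unfolding u_online_simple_def using os_bound_le_t
  by (subst cSUP_le_iff) (auto intro!: bdd_aboveI[of _ "int t"])

text \<open>The offset alone exceeds 1, and a single gain is positive only for a rejection with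
  threshold below 1. The improved procedures take values in \<open>nat\<close>, so they are strictly
  larger here.\<close>

lemma u_online_simple_1_neg:
  assumes "P 1 \<omega> > thr 1 \<omega> \<or> thr 1 \<omega> \<ge> 1"
  shows "u_online_simple \<alpha> P thr 1 \<omega> < 0"
proof -
  have "os_bound \<alpha> P thr a 1 \<omega> \<le> -1" if a: "a \<ge> 1" for a
  proof -
    have c: "c a > 1" using c_const_gt_1[OF \<alpha> a] .
    have "c a * real a \<ge> c a" using a c by simp
    moreover have "gain a 1 \<le> 0"
    proof (cases "thr 1 \<omega> \<ge> 1")
      case True
      then have "c a * thr 1 \<omega> \<ge> 1" using c mult_mono[of 1 "c a" 1 "thr 1 \<omega>"] by simp
      then show ?thesis by (simp add: gain_def)
    next
      case False
      then show ?thesis using assms a by (intro gain_nonrejected) auto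
    qed
    ultimately have "- c a * real a + gain a 1 \<le> -1"
      using c by linarith
    then show ?thesis
      by (simp add: os_bound_def gain_def ceiling_le_iff)
  qed
  then show ?thesis
    using u_online_simple_le_iff[of 1 "-1"] by simp
qed

subsection \<open>The closed procedures\<close>

lemma closed_bound_le:
  "I \<subseteq> {1..} \<Longrightarrow> \<phi> I = 0 \<Longrightarrow> closed_bound \<phi> S \<le> card (S - I)"
  unfolding closed_bound_def by (intro cInf_lower) auto

lemma test_os_eq_0_iff:
  "test_os \<alpha> P thr a \<omega> I = 0 \<longleftrightarrow> (\<forall>t\<in>I. wealth \<alpha> P thr a I t \<omega> < 1 / level \<alpha> a)"
  by (auto simp: test_os_def not_le)

lemma test_os_empty: "test_os \<alpha> P thr a \<omega> {} = 0"
  by (simp add: test_os_def)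

text \<open>An infimum of naturals is attained, and only \<open>I \<inter> {1..t}\<close> matters
  for rejections up to \<open>t\<close>. The search becomes finite, as measurability
  requires.\<close>

lemma closed_bound_le_iff:
  "closed_bound (test_os \<alpha> P thr a \<omega>) (rej t) \<le> k \<longleftrightarrow>
     (\<exists>I\<in>Pow {1..t}. test_os \<alpha> P thr a \<omega> I = 0 \<and> card (rej t - I) \<le> k)"
proof
  assume *: "closed_bound (test_os \<alpha> P thr a \<omega>) (rej t) \<le> k"
  let ?X = "{card (rej t - I) | I. I \<subseteq> {1..} \<and> test_os \<alpha> P thr a \<omega> I = 0}"
  have "Inf ?X \<in> ?X"
    using test_os_empty by (intro Inf_nat_def1) blast
  then obtain I where I: "I \<subseteq> {1..}" "test_os \<alpha> P thr a \<omega> I = 0" "card (rej t - I) \<le> k"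
    using * unfolding closed_bound_def by auto
  \<comment> \<open>Truncation leaves the wealth unchanged at times up to \<open>t\<close>, and the
    test for the truncated set inspects no others.\<close>
  have "wealth \<alpha> P thr a (I \<inter> {1..t}) s \<omega> = wealth \<alpha> P thr a I s \<omega>" if "s \<le> t" for s
    unfolding wealth_def using that by (intro prod.cong) auto
  then have "test_os \<alpha> P thr a \<omega> (I \<inter> {1..t}) = 0"
    using I(2) by (auto simp: test_os_eq_0_iff)
  moreover have "rej t - I \<inter> {1..t} = rej t - I"
    using rejected_subset by fastforce
  ultimately show "\<exists>I\<in>Pow {1..t}. test_os \<alpha> P thr a \<omega> I = 0 \<and> card (rej t - I) \<le> k"
    using I(3) by (intro bexI[of _ "I \<inter> {1..t}"]) auto
next
  assume "\<exists>I\<in>Pow {1..t}. test_os \<alpha> P thr a \<omega> I = 0 \<and> card (rej t - I) \<le> k"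
  then obtain I where "I \<subseteq> {1..t}" "test_os \<alpha> P thr a \<omega> I = 0" "card (rej t - I) \<le> k"
    by auto
  moreover from this have "I \<subseteq> {1..}" by auto
  ultimately show "closed_bound (test_os \<alpha> P thr a \<omega>) (rej t) \<le> k"
    using closed_bound_le[of I "test_os \<alpha> P thr a \<omega>" "rej t"] by simp
qed

lemma wealth_less_of_test_os:
  assumes "a \<ge> 1" "test_os \<alpha> P thr a \<omega> I = 0" "I \<subseteq> {1..t}"
  shows "(\<Prod>i\<in>I. E_os \<alpha> P thr a i \<omega>) < 1 / level \<alpha> a"
proof (cases "I = {}")
  case True
  then show ?thesis
    using ln_inverse_level_pos[OF \<alpha> assms(1)] \<alpha> weight_pos[OF assms(1)]
    by (simp add: level_eq_weight)
next
  case False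
  have fin: "finite I" using assms(3) finite_subset by blast
  \<comment> \<open>The test inspects only times in \<open>I\<close>; at the last of them the wealth
    is the full product.\<close>
  have "I \<inter> {1..Max I} = I"
    using assms(3) fin by auto
  then show ?thesis
    using assms(2) Max_in[OF fin False] by (auto simp: test_os_eq_0_iff wealth_def)
qed

text \<open>The unrejected set \<open>I\<close> attaining the closed bound has small wealth, so
  \<open>os_bound_le\<close> applies to its complement.\<close>

lemma os_bound_le_closed_bound:
  assumes "a \<ge> 1"
  shows "os_bound \<alpha> P thr a t \<omega> \<le> int (closed_bound (test_os \<alpha> P thr a \<omega>) (rej t))"
proof -
  obtain I where I: "I \<subseteq> {1..t}" "test_os \<alpha> P thr a \<omega> I = 0"
      "card (rej t - I) \<le> closed_bound (test_os \<alpha> P thr a \<omega>) (rej t)"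
    using closed_bound_le_iff[of a t] by auto
  have "{1..t} - ({1..t} - I) = I" using I(1) by auto
  then have "os_bound \<alpha> P thr a t \<omega> \<le> int (card (rej t \<inter> ({1..t} - I)))"
    using wealth_less_of_test_os[OF assms I(2,1)] by (intro os_bound_le assms) auto
  also have "rej t \<inter> ({1..t} - I) = rej t - I"
    using rejected_subset by fastforce
  finally show ?thesis using I(3) by linarith
qed

lemma closed_bound_le_card: "closed_bound (test_os \<alpha> P thr a \<omega>) (rej t) \<le> card (rej t)"
  using closed_bound_le[of "{}" "test_os \<alpha> P thr a \<omega>" "rej t"] by (simp add: test_os_empty)

lemma cu_online_simple_le_iff:
  "cu_online_simple \<alpha> P thr t \<omega> \<le> k \<longleftrightarrow>
     (\<forall>a\<ge>1. closed_bound (test_os \<alpha> P thr a \<omega>) (rej t) \<le> k)"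
  unfolding cu_online_simple_def using closed_bound_le_card
  by (subst cSUP_le_iff) (auto intro!: bdd_aboveI[of _ "card (rej t)"])

lemma u_le_cu: "u_online_simple \<alpha> P thr t \<omega> \<le> int (cu_online_simple \<alpha> P thr t \<omega>)"
  unfolding u_online_simple_le_iff
proof (intro allI impI)
  fix a :: nat assume a: "a \<ge> 1"
  have "closed_bound (test_os \<alpha> P thr a \<omega>) (rej t) \<le> cu_online_simple \<alpha> P thr t \<omega>"
    using cu_online_simple_le_iff[of t] a by blast
  then show "os_bound \<alpha> P thr a t \<omega> \<le> int (cu_online_simple \<alpha> P thr t \<omega>)"
    using os_bound_le_closed_bound[OF a, of t] by linarith
qed

text \<open>The mixture bound makes \<open>I\<close> itself an unrejected set for every
  \<open>a\<close>, hence a competitor in each infimum.\<close>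

lemma cu_le_of_mix_less:
  assumes "I \<subseteq> {1..}" "\<And>t. mix (I \<inter> {1..t}) < 1 / \<alpha>"
  shows "cu_online_simple \<alpha> P thr t \<omega> \<le> card (rej t - I)"
  unfolding cu_online_simple_le_iff
proof (intro allI impI closed_bound_le assms(1))
  fix a :: nat assume "a \<ge> 1"
  then show "test_os \<alpha> P thr a \<omega> I = 0"
    using assms(2) prod_E_os_less_of_mix_less[of "I \<inter> {1..s}" a for s]
    unfolding test_os_eq_0_iff wealth_def by fastforce
qed

subsection \<open>The short-cut algorithm\<close>

abbreviation "bd t \<equiv> fst (m_os_state \<alpha> P thr t \<omega>)"
abbreviation "excl t \<equiv> snd (m_os_state \<alpha> P thr t \<omega>)"

lemma m_os_state_Suc:
  "m_os_state \<alpha> P thr (Suc t) \<omega> =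
     (if mix ({1..Suc t} - excl t) \<ge> 1 / \<alpha>
      then (bd t + 1, insert (smallest_thr_index thr (rej (Suc t) - excl t) \<omega>) (excl t))
      else (bd t, excl t))"
  by (simp add: mixture_def weight_def Let_def split_def)

declare m_os_state.simps(2) [simp del]

text \<open>A non-rejection adds a nonpositive gain and cannot lift the mixture to
  \<open>1 / \<alpha>\<close>.\<close>

lemma update_rejects:
  assumes "mix ({1..t} - B) < 1 / \<alpha>" "B \<subseteq> {1..t}" "1 / \<alpha> \<le> mix ({1..Suc t} - B)"
  shows "P (Suc t) \<omega> \<le> thr (Suc t) \<omega>"
proof (rule ccontr)
  assume *: "\<not> P (Suc t) \<omega> \<le> thr (Suc t) \<omega>"
  have eq: "{1..Suc t} - B = insert (Suc t) ({1..t} - B)" using assms(2) by auto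
  have "mix ({1..Suc t} - B) \<le> mix ({1..t} - B)"
  proof (rule mix_mono)
    fix a :: nat assume "a \<ge> 1"
    then show "(\<Sum>i\<in>{1..Suc t} - B. gain a i) \<le> (\<Sum>i\<in>{1..t} - B. gain a i)"
      unfolding eq using gain_nonrejected[OF _ _ *, of a] by simp
  qed auto
  then show False using assms by linarith
qed

lemma m_os_state_invariant:
  "excl t \<subseteq> rej t \<and> card (excl t) = bd t \<and> mix ({1..t} - excl t) < 1 / \<alpha>"
proof (induction t)
  case 0
  then show ?case using \<alpha> by (simp add: mix_empty)
next
  case (Suc t)
  let ?C = "excl t"
  have C: "?C \<subseteq> {1..t}" using Suc rejected_subset by fastforce
  show ?case
  proof (cases "mix ({1..Suc t} - ?C) \<ge> 1 / \<alpha>")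
    case False
    then show ?thesis using Suc by (auto simp: m_os_state_Suc rejected_Suc)
  next
    case True
    have rej: "P (Suc t) \<omega> \<le> thr (Suc t) \<omega>"
      using update_rejects[OF _ C True] Suc by blast
    \<comment> \<open>The new index is itself a candidate, so the greedy choice is well defined and
      its threshold is at most the new one.\<close>
    then have new: "Suc t \<in> rej (Suc t) - ?C" using C by (auto simp: mem_rejected)
    define j where "j = smallest_thr_index thr (rej (Suc t) - ?C) \<omega>"
    have j: "j \<in> rej (Suc t) - ?C" "thr j \<omega> \<le> thr (Suc t) \<omega>"
      using smallest_thr_index_works[where B = "rej (Suc t) - ?C" and thr = thr and \<omega> = \<omega>] new unfolding j_def by auto
    have state: "m_os_state \<alpha> P thr (Suc t) \<omega> = (bd t + 1, insert j ?C)"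
      using True by (simp add: m_os_state_Suc j_def)
    \<comment> \<open>The update trades \<open>j\<close> for \<open>Suc t\<close>. Both are
      rejections, and the smaller threshold of \<open>j\<close> means the larger gain, so the
      mixture does not exceed its previous value.\<close>
    have "mix ({1..Suc t} - insert j ?C) \<le> mix ({1..t} - ?C)"
    proof (rule mix_mono)
      fix a :: nat assume a: "a \<ge> 1"
      have "gain a (Suc t) \<le> gain a j"
        using j rej c_const_gt_1[OF \<alpha> a] by (simp add: gain_rejected mem_rejected)
      moreover have "(\<Sum>i\<in>{1..Suc t} - ?C. gain a i)
          = (\<Sum>i\<in>{1..Suc t} - insert j ?C. gain a i) + gain a j"
      proof -
        have "j \<in> {1..Suc t} - ?C"
          using j(1) rejected_subset[of P thr "Suc t" \<omega>] by blast
        moreover have "{1..Suc t} - insert j ?C = {1..Suc t} - ?C - {j}"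
          by blast
        ultimately show ?thesis
          using sum.remove[of "{1..Suc t} - ?C" j "gain a"] by simp
      qed
      moreover have "{1..Suc t} - ?C = insert (Suc t) ({1..t} - ?C)"
        using C by auto
      then have "(\<Sum>i\<in>{1..Suc t} - ?C. gain a i)
          = gain a (Suc t) + (\<Sum>i\<in>{1..t} - ?C. gain a i)"
        by simp
      ultimately show "(\<Sum>i\<in>{1..Suc t} - insert j ?C. gain a i) \<le> (\<Sum>i\<in>{1..t} - ?C. gain a i)"
        by linarith
    qed auto
    moreover have "card (insert j ?C) = Suc (card ?C)"
      using j(1) C finite_subset by (subst card_insert_disjoint) auto
    moreover have "insert j ?C \<subseteq> rej (Suc t)"
      using j(1) Suc by (auto simp: rejected_Suc)
    ultimately show ?thesis using Suc unfolding state by simp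
  qed
qed

lemma excl_subset: "excl t \<subseteq> rej t"
  and card_excl: "card (excl t) = bd t"
  and mix_excl: "mix ({1..t} - excl t) < 1 / \<alpha>"
  using m_os_state_invariant by auto

lemma excl_subset_atMost: "excl t \<subseteq> {1..t}"
  using excl_subset[of t] rejected_subset[of P thr t \<omega>] by blast

lemma finite_excl: "finite (excl t)"
  by (rule finite_subset[OF excl_subset finite_rejected])

lemma excl_mono: "s \<le> t \<Longrightarrow> excl s \<subseteq> excl t"
proof (induction t rule: dec_induct)
  case (step n)
  then show ?case by (auto simp: m_os_state_Suc)
qed simp

text \<open>The exclusions serve as \<open>B\<close> in \<open>os_bound_le\<close>, for all
  \<open>a\<close> simultaneously.\<close>

lemma u_le_m: "u_online_simple \<alpha> P thr t \<omega> \<le> int (m_online_simple \<alpha> P thr t \<omega>)"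
  unfolding u_online_simple_le_iff
proof (intro allI impI)
  fix a :: nat assume a: "a \<ge> 1"
  have "os_bound \<alpha> P thr a t \<omega> \<le> int (card (rej t \<inter> excl t))"
    using a mix_excl excl_subset_atMost
    by (intro os_bound_le prod_E_os_less_of_mix_less) auto
  also have "rej t \<inter> excl t = excl t"
    using excl_subset by blast
  finally show "os_bound \<alpha> P thr a t \<omega> \<le> int (m_online_simple \<alpha> P thr t \<omega>)"
    by (simp add: card_excl m_online_simple_def)
qed

text \<open>The exclusions up to time \<open>s\<close> can only be drawn from the rejections up to time \<open>s\<close>; among
  all sets meeting this constraint the greedy choice has the smallest sum of thresholds. The
  exchange step removes the latest element of \<open>B\<close> that was never excluded.\<close>

lemma greedy_optimal:
  assumes "B \<subseteq> rej t" "card B = bd t" "\<And>s. s \<le> t \<Longrightarrow> bd s \<le> card (B \<inter> {1..s})"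
  shows "(\<Sum>i\<in>excl t. thr i \<omega>) \<le> (\<Sum>i\<in>B. thr i \<omega>)"
  using assms
proof (induction t arbitrary: B)
  case 0
  then have "B = {}" using rejected_subset[of P thr 0 \<omega>] by auto
  then show ?case by simp
next
  case (Suc t)
  let ?C = "excl t"
  have finB: "finite B" by (rule finite_subset[OF Suc.prems(1) finite_rejected])
  have Bsub: "B \<subseteq> {1..Suc t}" using Suc.prems(1) rejected_subset by fastforce
  show ?case
  proof (cases "mix ({1..Suc t} - ?C) \<ge> 1 / \<alpha>")
    case False
    then have st: "m_os_state \<alpha> P thr (Suc t) \<omega> = (bd t, ?C)"
      by (simp add: m_os_state_Suc)
    \<comment> \<open>Without an update the prefix condition at \<open>s = t\<close> already demands
      \<open>card B\<close> elements up to \<open>t\<close>, which forces \<open>Suc t\<close> out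
      of \<open>B\<close>.\<close>
    have "card B \<le> card (B \<inter> {1..t})"
      using Suc.prems(2) Suc.prems(3)[of t] by (simp add: st)
    then have "B \<inter> {1..t} = B"
      using finB by (intro card_seteq) auto
    then have "B \<subseteq> rej t"
      using Suc.prems(1) by (fastforce simp: mem_rejected)
    then show ?thesis
      using Suc.IH[of B] Suc.prems by (simp add: st)
  next
    case True
    define j where "j = smallest_thr_index thr (rej (Suc t) - ?C) \<omega>"
    have st: "m_os_state \<alpha> P thr (Suc t) \<omega> = (Suc (bd t), insert j ?C)"
      using True by (simp add: m_os_state_Suc j_def)
    have cardB: "card B = Suc (bd t)" using Suc.prems(2) by (simp add: st)
    \<comment> \<open>The element \<open>b\<close> must lie outside \<open>?C\<close>, so that it
      competes with \<open>j\<close>, and removing it must preserve the prefix conditions up to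
      \<open>t\<close>.\<close>
    have "\<exists>b \<in> B - ?C. B - {b} \<subseteq> {1..t} \<and> (\<forall>s\<le>t. bd s \<le> card ((B - {b}) \<inter> {1..s}))"
    proof (cases "Suc t \<in> B")
      case True
      have "(B - {Suc t}) \<inter> {1..s} = B \<inter> {1..s}" if "s \<le> t" for s
        using that by auto
      then show ?thesis
        using True Bsub Suc.prems(3) excl_subset_atMost[of t]
        by (intro bexI[of _ "Suc t"]) (auto simp: le_Suc_eq)
    next
      case False
      then have Bt: "B \<subseteq> {1..t}" using Bsub by (auto simp: le_Suc_eq)
      have "\<not> B \<subseteq> ?C"
        using card_mono[OF finite_excl, of B t] cardB by (auto simp: card_excl)
      then have ne: "B - ?C \<noteq> {}" by auto
      define b where "b = Max (B - ?C)"
      have b: "b \<in> B - ?C" and bmax: "\<And>i. i \<in> B - ?C \<Longrightarrow> i \<le> b"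
        unfolding b_def using finB ne Max_in[of "B - ?C"] by auto
      have "bd s \<le> card ((B - {b}) \<inter> {1..s})" if s: "s \<le> t" for s
      proof (cases "b \<le> s")
        case False
        then have "(B - {b}) \<inter> {1..s} = B \<inter> {1..s}" by auto
        then show ?thesis using Suc.prems(3)[of s] s by simp
      next
        case True
        \<comment> \<open>By maximality of \<open>b\<close>, elements of \<open>B\<close> beyond
          \<open>s\<close> belong to \<open>?C\<close>, and none was excluded by time
          \<open>s\<close>. There are at most \<open>bd t - bd s\<close> of them, so
          \<open>B\<close> has at least \<open>bd s + 1\<close> elements up to \<open>s\<close> and
          can spare \<open>b\<close>.\<close>
        have "B - {1..s} \<subseteq> ?C - excl s"
          using bmax True Bt excl_subset_atMost[of s] by fastforce
        then have "card (B - {1..s}) \<le> card (?C - excl s)"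
          using finite_excl by (intro card_mono) auto
        also have "\<dots> = bd t - bd s"
          using excl_mono[OF s] by (simp add: card_Diff_subset finite_excl card_excl)
        finally have "card (B - {1..s}) \<le> bd t - bd s" .
        moreover have "bd s \<le> bd t"
          using card_mono[OF finite_excl excl_mono[OF s]] by (simp add: card_excl)
        moreover have "card B = card (B \<inter> {1..s}) + card (B - {1..s})"
          using finB by (rule card_Int_Diff)
        moreover have "(B - {b}) \<inter> {1..s} = B \<inter> {1..s} - {b}" "b \<in> B \<inter> {1..s}"
          using b True Bt by auto
        ultimately show ?thesis using cardB finB by simp
      qed
      then show ?thesis using b Bt by auto
    qed
    then obtain b where b: "b \<in> B" "b \<notin> ?C" "B - {b} \<subseteq> {1..t}"
      and feas: "\<And>s. s \<le> t \<Longrightarrow> bd s \<le> card ((B - {b}) \<inter> {1..s})" by blast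
    have "B - {b} \<subseteq> rej t"
      using Suc.prems(1) b(3) by (fastforce simp: mem_rejected)
    then have IH: "(\<Sum>i\<in>?C. thr i \<omega>) \<le> (\<Sum>i\<in>B - {b}. thr i \<omega>)"
      using Suc.IH[of "B - {b}"] feas cardB b(1) finB by simp
    have bin: "b \<in> rej (Suc t) - ?C" using b Suc.prems(1) by auto
    then have j: "j \<notin> ?C" "thr j \<omega> \<le> thr b \<omega>"
      using smallest_thr_index_works[where B = "rej (Suc t) - ?C" and thr = thr and \<omega> = \<omega>] unfolding j_def by auto
    have "(\<Sum>i\<in>B. thr i \<omega>) = thr b \<omega> + (\<Sum>i\<in>B - {b}. thr i \<omega>)"
      using b(1) finB by (simp add: sum.remove)
    then show ?thesis
      using IH j finite_excl by (simp add: st)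
  qed
qed

text \<open>At a first violation the previous bound equals the number of rejections outside
  \<open>I\<close>, so those rejections compete with the greedy exclusions. Optimality then bounds
  the update statistic by the mixture over \<open>I\<close>, contradicting the update.\<close>

lemma m_le_of_mix_less:
  assumes I: "I \<subseteq> {1..}" and mixI: "\<And>t. mix (I \<inter> {1..t}) < 1 / \<alpha>"
  shows "bd t \<le> card (rej t - I)"
proof (induction t rule: less_induct)
  case (less t)
  show ?case
  proof (cases t)
    case 0
    then show ?thesis by simp
  next
    case (Suc r)
    let ?B = "rej r - I"
    have IH: "bd s \<le> card (rej s - I)" if "s \<le> r" for s
      using less Suc that by simp
    have sub: "?B \<subseteq> rej t - I" by (auto simp: Suc rejected_Suc)
    have mono: "card ?B \<le> card (rej t - I)" by (intro card_mono sub) simp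
    show ?thesis
    proof (rule ccontr)
      assume neg: "\<not> ?thesis"
      have upd: "1 / \<alpha> \<le> mix ({1..Suc r} - excl r)"
        using neg IH[of r] mono by (auto simp: Suc m_os_state_Suc split: if_splits)
      then have "bd t = Suc (bd r)" by (simp add: Suc m_os_state_Suc)
      then have eq: "card ?B = bd r" "card (rej t - I) = card ?B"
        using neg IH[of r] mono by auto
      \<comment> \<open>Step \<open>t\<close> adds no rejection outside \<open>I\<close>, so indices
        of \<open>{1..t} - I\<close> outside \<open>?B\<close> are not rejected and have nonpositive
        gain.\<close>
      have Beq: "rej t - I = ?B"
        using eq(2) by (intro card_seteq[symmetric] sub) auto
      have "P t \<omega> \<le> thr t \<omega>"
        using update_rejects[OF mix_excl excl_subset_atMost upd] Suc by simp
      then have "t \<in> rej t" "t \<notin> ?B" using Suc by (auto simp: mem_rejected)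
      then have tI: "t \<in> I" using Beq by blast
      \<comment> \<open>The induction hypothesis at all earlier times is exactly the prefix
        condition of \<open>greedy_optimal\<close>.\<close>
      have "(\<Sum>i\<in>excl r. thr i \<omega>) \<le> (\<Sum>i\<in>?B. thr i \<omega>)"
      proof (rule greedy_optimal)
        fix s assume s: "s \<le> r"
        have "?B \<inter> {1..s} = rej s - I" using s by (auto simp: mem_rejected)
        then show "bd s \<le> card (?B \<inter> {1..s})" using IH[OF s] by simp
      qed (use eq in auto)
      moreover have "(\<Sum>i\<in>C. gain a i) = card C - c a * (\<Sum>i\<in>C. thr i \<omega>)"
        if "C \<subseteq> rej r" for C a
      proof -
        have "(\<Sum>i\<in>C. gain a i) = (\<Sum>i\<in>C. 1 - c a * thr i \<omega>)"
          using that by (intro sum.cong) (auto simp: gain_rejected mem_rejected)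
        then show ?thesis by (simp add: sum_subtractf sum_distrib_left)
      qed
      ultimately have cmp: "(\<Sum>i\<in>?B. gain a i) \<le> (\<Sum>i\<in>excl r. gain a i)" if "a \<ge> 1" for a
        using c_const_gt_1[OF \<alpha> that] excl_subset[of r] eq(1)
        by (simp add: card_excl mult_left_mono)
      have "mix ({1..t} - excl r) \<le> mix (I \<inter> {1..t})"
      proof (rule mix_mono)
        fix a :: nat assume a: "a \<ge> 1"
        have *: "(\<Sum>i\<in>{1..t} - I. gain a i) \<le> (\<Sum>i\<in>?B. gain a i)"
        proof -
          have "?B \<subseteq> {1..t} - I"
            unfolding Beq[symmetric] using rejected_subset[of P thr t \<omega>] by blast
          then have "(\<Sum>i\<in>{1..t} - I. gain a i)
              = (\<Sum>i\<in>{1..t} - I - ?B. gain a i) + (\<Sum>i\<in>?B. gain a i)"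
            by (intro sum.subset_diff) auto
          moreover have "(\<Sum>i\<in>{1..t} - I - ?B. gain a i) \<le> 0"
            unfolding Beq[symmetric]
            using a by (intro sum_nonpos gain_nonrejected) (auto simp: mem_rejected)
          ultimately show ?thesis by simp
        qed
        \<comment> \<open>Both sets are complements in \<open>{1..t}\<close>: removing the larger
          gain of \<open>excl r\<close> leaves the smaller remainder.\<close>
        have "(\<Sum>i\<in>{1..t}. gain a i) = (\<Sum>i\<in>{1..t} - I. gain a i) + (\<Sum>i\<in>I \<inter> {1..t}. gain a i)"
          using sum.Int_Diff[of "{1..t}" "gain a" I] by (simp add: Int_commute)
        moreover have "(\<Sum>i\<in>{1..t}. gain a i) = (\<Sum>i\<in>{1..t} - excl r. gain a i) + (\<Sum>i\<in>excl r. gain a i)"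
          using excl_subset_atMost[of r] Suc by (intro sum.subset_diff) auto
        ultimately show "(\<Sum>i\<in>{1..t} - excl r. gain a i) \<le> (\<Sum>i\<in>I \<inter> {1..t}. gain a i)"
          using cmp[OF a] * by linarith
      qed (use I in auto)
      then show False using upd mixI[of t] Suc by simp
    qed
  qed
qed

end

subsection \<open>E-values and Ville's inequality\<close>

text \<open>The weight \<open>Y\<close> is known given \<open>F\<close>, so the indicator may be
  replaced by its conditional expectation, which is at most \<open>x\<close>. For
  \<open>x > 1\<close> the indicator bound 1 suffices.\<close>

lemma (in finite_measure_subalgebra) nn_integral_indicator_le_const:
  assumes p [measurable]: "p \<in> borel_measurable M" and Y: "Y \<in> borel_measurable F"
    and valid: "\<And>x. 0 \<le> x \<Longrightarrow> x \<le> 1 \<Longrightarrow>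
      AE \<omega> in M. real_cond_exp M F (indicator {\<omega> \<in> space M. p \<omega> \<le> x}) \<omega> \<le> x"
    and x: "0 \<le> x"
  shows "(\<integral>\<^sup>+\<omega>. Y \<omega> * indicator {\<omega> \<in> space M. p \<omega> \<le> x} \<omega> \<partial>M) \<le> (\<integral>\<^sup>+\<omega>. Y \<omega> * ennreal x \<partial>M)"
proof (cases "x \<le> 1")
  case False
  then have "1 \<le> ennreal x" by simp
  then show ?thesis
    by (intro nn_integral_mono mult_left_mono) (auto simp: indicator_def)
next
  case True
  define B where "B = {\<omega> \<in> space M. p \<omega> \<le> x}"
  have [measurable]: "B \<in> sets M" by (simp add: B_def)
  let ?g = "\<lambda>\<omega>. ennreal (indicator B \<omega>)"
  \<comment> \<open>Finiteness almost everywhere matters because \<open>enn2real\<close> sends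
    infinity to 0, which would hide an infinite \<open>nn_cond_exp\<close>.\<close>
  have "(\<integral>\<^sup>+\<omega>. 1 * nn_cond_exp M F ?g \<omega> \<partial>M) = (\<integral>\<^sup>+\<omega>. 1 * ?g \<omega> \<partial>M)"
    by (rule nn_cond_exp_intg) auto
  also have "\<dots> = emeasure M B"
    by (simp add: ennreal_indicator)
  finally have "(\<integral>\<^sup>+\<omega>. nn_cond_exp M F ?g \<omega> \<partial>M) \<noteq> \<infinity>"
    by simp
  then have fin: "AE \<omega> in M. nn_cond_exp M F ?g \<omega> \<noteq> \<infinity>"
    by (intro nn_integral_PInf_AE) auto
  \<comment> \<open>\<open>real_cond_exp\<close> subtracts the conditional expectation of the
    negative part, which vanishes for an indicator.\<close>
  have "AE \<omega> in M. (0::ennreal) = nn_cond_exp M F (\<lambda>_. 0) \<omega>"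
    by (intro nn_cond_exp_F_meas) auto
  moreover have "(\<lambda>\<omega>. ennreal (- indicator B \<omega>)) = (\<lambda>_. 0)"
    by (auto simp: indicator_def ennreal_neg)
  ultimately have "AE \<omega> in M. nn_cond_exp M F (\<lambda>\<omega>. ennreal (- indicator B \<omega>)) \<omega> = 0"
    by auto
  with fin valid[OF x True]
  have le: "AE \<omega> in M. nn_cond_exp M F ?g \<omega> \<le> ennreal x"
    unfolding B_def[symmetric]
  proof eventually_elim
    case (elim \<omega>)
    then have "enn2real (nn_cond_exp M F ?g \<omega>) \<le> x"
      by (simp add: real_cond_exp_def)
    then show ?case
      using elim(1) by (metis ennreal_enn2real ennreal_leI infinity_ennreal_def less_top)
  qed
  have "(\<integral>\<^sup>+\<omega>. Y \<omega> * indicator B \<omega> \<partial>M) = (\<integral>\<^sup>+\<omega>. Y \<omega> * nn_cond_exp M F ?g \<omega> \<partial>M)"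
    using nn_cond_exp_intg[OF Y, of ?g] by (simp add: ennreal_indicator)
  also have "\<dots> \<le> (\<integral>\<^sup>+\<omega>. Y \<omega> * ennreal x \<partial>M)"
    using le by (intro nn_integral_mono_AE) (auto elim!: eventually_mono intro: mult_left_mono)
  finally show ?thesis by (simp add: B_def)
qed

text \<open>The threshold is rounded up to a grid of width \<open>\<delta>\<close>, and each grid value contributes a
  constant threshold.\<close>

lemma (in finite_measure_subalgebra) nn_integral_indicator_le:
  assumes p [measurable]: "p \<in> borel_measurable M" and Y: "Y \<in> borel_measurable F"
    and valid: "\<And>x. 0 \<le> x \<Longrightarrow> x \<le> 1 \<Longrightarrow>
      AE \<omega> in M. real_cond_exp M F (indicator {\<omega> \<in> space M. p \<omega> \<le> x}) \<omega> \<le> x"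
    and r: "r \<in> borel_measurable F" "\<And>\<omega>. \<omega> \<in> space M \<Longrightarrow> 0 \<le> r \<omega>"
    and fin: "(\<integral>\<^sup>+\<omega>. Y \<omega> \<partial>M) < \<infinity>"
  shows "(\<integral>\<^sup>+\<omega>. Y \<omega> * indicator {\<omega> \<in> space M. p \<omega> \<le> r \<omega>} \<omega> \<partial>M)
    \<le> (\<integral>\<^sup>+\<omega>. Y \<omega> * ennreal (r \<omega>) \<partial>M)"
proof (rule ennreal_le_epsilon)
  fix e :: real assume e: "0 < e"
  have [measurable]: "Y \<in> borel_measurable M" "r \<in> borel_measurable M"
    using measurable_from_subalg[OF subalg] Y r(1) by auto
  define C where "C = enn2real (\<integral>\<^sup>+\<omega>. Y \<omega> \<partial>M)"
  have C: "(\<integral>\<^sup>+\<omega>. Y \<omega> \<partial>M) = ennreal C" "0 \<le> C"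
    using fin by (auto simp: C_def)
  \<comment> \<open>The total rounding error is \<open>\<delta> * C\<close>, at most
    \<open>e\<close>; the \<open>+ 1\<close> avoids a zero denominator.\<close>
  define \<delta> where "\<delta> = e / (C + 1)"
  have \<delta>: "0 < \<delta>" "\<delta> * C \<le> e"
    using e C by (auto simp: \<delta>_def field_simps)
  \<comment> \<open>The grid cell of the threshold; \<open>x n\<close> is the upper end of cell
    \<open>n\<close>, hence its \<open>+ 1\<close>.\<close>
  define k where "k \<omega> = nat \<lfloor>r \<omega> / \<delta>\<rfloor>" for \<omega>
  define x where "x n = (real n + 1) * \<delta>" for n
  define D where "D n = {\<omega> \<in> space F. k \<omega> = n}" for n
  have kF: "k \<in> measurable F (count_space UNIV)"
    unfolding k_def using r(1) by measurable
  have D: "D n \<in> sets F" for n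
    unfolding D_def using kF by measurable
  have spF: "space F = space M" using subalg by (simp add: subalgebra_def)
  have DM [measurable]: "D n \<in> sets M" for n
    using D subalg by (auto simp: subalgebra_def)
  have single: "(\<Sum>n. f n * indicator (D n) \<omega>) = f (k \<omega>)" if "\<omega> \<in> space M" for f :: "nat \<Rightarrow> ennreal" and \<omega>
  proof -
    have "(\<lambda>n. f n * indicator (D n) \<omega>) = (\<lambda>n. if n = k \<omega> then f n else 0)"
      using that by (auto simp: D_def spF indicator_def)
    then show ?thesis using sums_single[of "k \<omega>" f] by (simp add: sums_iff)
  qed
  have rk: "r \<omega> \<le> x (k \<omega>)" "x (k \<omega>) \<le> r \<omega> + \<delta>" if "\<omega> \<in> space M" for \<omega>
  proof -
    have "0 \<le> r \<omega> / \<delta>" using r(2)[OF that] \<delta>(1) by simp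
    then have "real (k \<omega>) \<le> r \<omega> / \<delta>" "r \<omega> / \<delta> \<le> real (k \<omega>) + 1"
      unfolding k_def by linarith+
    then show "r \<omega> \<le> x (k \<omega>)" "x (k \<omega>) \<le> r \<omega> + \<delta>"
      using \<delta>(1) by (auto simp: x_def field_simps)
  qed
  have "(\<integral>\<^sup>+\<omega>. Y \<omega> * indicator {\<omega> \<in> space M. p \<omega> \<le> r \<omega>} \<omega> \<partial>M)
    \<le> (\<integral>\<^sup>+\<omega>. (\<Sum>n. Y \<omega> * indicator {\<omega> \<in> space M. p \<omega> \<le> x n} \<omega> * indicator (D n) \<omega>) \<partial>M)"
  proof (rule nn_integral_mono)
    fix \<omega> assume \<omega>: "\<omega> \<in> space M"
    have "Y \<omega> * indicator {\<omega> \<in> space M. p \<omega> \<le> r \<omega>} \<omega>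
        \<le> Y \<omega> * indicator {\<omega>' \<in> space M. p \<omega>' \<le> x (k \<omega>)} \<omega>"
      using \<omega> rk(1)[OF \<omega>] by (auto simp: indicator_def)
    then show "Y \<omega> * indicator {\<omega> \<in> space M. p \<omega> \<le> r \<omega>} \<omega>
        \<le> (\<Sum>n. Y \<omega> * indicator {\<omega> \<in> space M. p \<omega> \<le> x n} \<omega> * indicator (D n) \<omega>)"
      using single[OF \<omega>, of "\<lambda>n. Y \<omega> * indicator {\<omega> \<in> space M. p \<omega> \<le> x n} \<omega>"]
      by (simp only:)
  qed
  also have "\<dots> = (\<Sum>n. \<integral>\<^sup>+\<omega>. Y \<omega> * indicator {\<omega> \<in> space M. p \<omega> \<le> x n} \<omega> * indicator (D n) \<omega> \<partial>M)"
    by (intro nn_integral_suminf) measurable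
  also have "\<dots> \<le> (\<Sum>n. \<integral>\<^sup>+\<omega>. Y \<omega> * ennreal (x n) * indicator (D n) \<omega> \<partial>M)"
  proof (intro suminf_le summableI)
    fix n
    \<comment> \<open>The cell is determined by \<open>r\<close>, so its indicator joins the
      \<open>F\<close>-measurable weight.\<close>
    have "(\<lambda>\<omega>. Y \<omega> * indicator (D n) \<omega>) \<in> borel_measurable F"
      using Y D by measurable
    from nn_integral_indicator_le_const[OF p this valid, of "x n"]
    show "(\<integral>\<^sup>+\<omega>. Y \<omega> * indicator {\<omega> \<in> space M. p \<omega> \<le> x n} \<omega> * indicator (D n) \<omega> \<partial>M)
      \<le> (\<integral>\<^sup>+\<omega>. Y \<omega> * ennreal (x n) * indicator (D n) \<omega> \<partial>M)"
      using \<delta>(1) by (simp add: x_def mult_ac)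
  qed
  also have "\<dots> = (\<integral>\<^sup>+\<omega>. (\<Sum>n. Y \<omega> * ennreal (x n) * indicator (D n) \<omega>) \<partial>M)"
    by (intro nn_integral_suminf[symmetric]) measurable
  also have "\<dots> \<le> (\<integral>\<^sup>+\<omega>. Y \<omega> * ennreal (r \<omega>) + ennreal \<delta> * Y \<omega> \<partial>M)"
  proof (intro nn_integral_mono)
    fix \<omega> assume \<omega>: "\<omega> \<in> space M"
    have "Y \<omega> * ennreal (x (k \<omega>)) \<le> Y \<omega> * ennreal (r \<omega> + \<delta>)"
      using rk(2)[OF \<omega>] by (intro mult_left_mono ennreal_leI) auto
    also have "\<dots> = Y \<omega> * ennreal (r \<omega>) + ennreal \<delta> * Y \<omega>"
      using r(2)[OF \<omega>] \<delta>(1) by (simp add: ennreal_plus distrib_left mult.commute)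
    finally show "(\<Sum>n. Y \<omega> * ennreal (x n) * indicator (D n) \<omega>) \<le> Y \<omega> * ennreal (r \<omega>) + ennreal \<delta> * Y \<omega>"
      by (simp add: single[OF \<omega>])
  qed
  also have "\<dots> = (\<integral>\<^sup>+\<omega>. Y \<omega> * ennreal (r \<omega>) \<partial>M) + ennreal \<delta> * (\<integral>\<^sup>+\<omega>. Y \<omega> \<partial>M)"
    by (simp add: nn_integral_add nn_integral_cmult)
  also have "ennreal \<delta> * (\<integral>\<^sup>+\<omega>. Y \<omega> \<partial>M) \<le> ennreal e"
    using \<delta> C by (simp add: ennreal_mult[symmetric] ennreal_leI)
  finally show "(\<integral>\<^sup>+\<omega>. Y \<omega> * indicator {\<omega> \<in> space M. p \<omega> \<le> r \<omega>} \<omega> \<partial>M)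
    \<le> (\<integral>\<^sup>+\<omega>. Y \<omega> * ennreal (r \<omega>) \<partial>M) + ennreal e"
    by (simp add: add_left_mono)
qed

text \<open>\<open>E_os\<close> is an e-variable: with \<open>b = exp \<theta> - 1 = \<theta> c\<close> its conditional mean is at most
  \<open>exp (- b r) (1 + b r) \<le> 1\<close>.\<close>

lemma (in finite_measure_subalgebra) nn_integral_E_os_le:
  assumes \<alpha>: "0 < \<alpha>" "\<alpha> < 1" "a \<ge> 1"
    and p [measurable]: "P i \<in> borel_measurable M" and Z: "Z \<in> borel_measurable F"
    and valid: "\<And>x. 0 \<le> x \<Longrightarrow> x \<le> 1 \<Longrightarrow>
      AE \<omega> in M. real_cond_exp M F (indicator {\<omega> \<in> space M. P i \<omega> \<le> x}) \<omega> \<le> x"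
    and r: "thr i \<in> borel_measurable F" "\<And>\<omega>. \<omega> \<in> space M \<Longrightarrow> 0 \<le> thr i \<omega>"
    and fin: "(\<integral>\<^sup>+\<omega>. Z \<omega> \<partial>M) < \<infinity>"
  shows "(\<integral>\<^sup>+\<omega>. Z \<omega> * ennreal (E_os \<alpha> P thr a i \<omega>) \<partial>M) \<le> (\<integral>\<^sup>+\<omega>. Z \<omega> \<partial>M)"
proof -
  have [measurable]: "Z \<in> borel_measurable M" "thr i \<in> borel_measurable M"
    using measurable_from_subalg[OF subalg] Z r(1) by auto
  define b where "b = exp (theta \<alpha> a) - 1"
  have b: "0 < b" using theta_pos[OF \<alpha>] by (simp add: b_def)
  have b_eq: "theta \<alpha> a * c_const \<alpha> a = b"
  proof -
    have "theta \<alpha> a * c_const \<alpha> a = ln (1 / level \<alpha> a) / real a"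
      using theta_c_const[OF \<alpha>] \<alpha>(3) by (subst eq_divide_eq) (auto simp: mult.assoc)
    then show ?thesis using exp_theta[OF \<alpha>] by (simp add: b_def)
  qed
  define Y where "Y \<omega> = Z \<omega> * ennreal (exp (- (b * thr i \<omega>)))" for \<omega>
  have YF: "Y \<in> borel_measurable F"
    unfolding Y_def using Z r(1) by measurable
  have [measurable]: "Y \<in> borel_measurable M"
    using measurable_from_subalg[OF subalg YF] .
  let ?B = "{\<omega> \<in> space M. P i \<omega> \<le> thr i \<omega>}"
  have "(\<integral>\<^sup>+\<omega>. Y \<omega> \<partial>M) \<le> (\<integral>\<^sup>+\<omega>. Z \<omega> \<partial>M)"
  proof (rule nn_integral_mono)
    fix \<omega> assume "\<omega> \<in> space M"
    then have "Z \<omega> * ennreal (exp (- (b * thr i \<omega>))) \<le> Z \<omega> * 1"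
      using b r(2) by (intro mult_left_mono) auto
    then show "Y \<omega> \<le> Z \<omega>" by (simp add: Y_def)
  qed
  then have finY: "(\<integral>\<^sup>+\<omega>. Y \<omega> \<partial>M) < \<infinity>" using fin by (simp add: le_less_trans)
  have "(\<integral>\<^sup>+\<omega>. Z \<omega> * ennreal (E_os \<alpha> P thr a i \<omega>) \<partial>M)
      = (\<integral>\<^sup>+\<omega>. Y \<omega> + ennreal b * (Y \<omega> * indicator ?B \<omega>) \<partial>M)"
  proof (rule nn_integral_cong)
    fix \<omega> assume \<omega>: "\<omega> \<in> space M"
    have "E_os \<alpha> P thr a i \<omega> = exp (theta \<alpha> a * of_bool (P i \<omega> \<le> thr i \<omega>) - b * thr i \<omega>)"
      by (simp add: E_os_def right_diff_distrib b_eq[symmetric] mult.assoc)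
    \<comment> \<open>The indicator is 0 or 1, so its exponential is affine with slope
      \<open>b\<close>.\<close>
    also have "\<dots> = exp (- (b * thr i \<omega>)) * (1 + b * indicator ?B \<omega>)"
      using \<omega> by (cases "P i \<omega> \<le> thr i \<omega>") (simp_all add: b_def exp_diff exp_minus divide_inverse)
    finally have "ennreal (E_os \<alpha> P thr a i \<omega>)
        = ennreal (exp (- (b * thr i \<omega>))) * (1 + ennreal b * indicator ?B \<omega>)"
      using b by (simp add: ennreal_mult' ennreal_plus ennreal_indicator)
    then show "Z \<omega> * ennreal (E_os \<alpha> P thr a i \<omega>) = Y \<omega> + ennreal b * (Y \<omega> * indicator ?B \<omega>)"
      by (simp add: Y_def distrib_left mult_ac)
  qed
  also have "\<dots> = (\<integral>\<^sup>+\<omega>. Y \<omega> \<partial>M) + ennreal b * (\<integral>\<^sup>+\<omega>. Y \<omega> * indicator ?B \<omega> \<partial>M)"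
    by (simp add: nn_integral_add nn_integral_cmult)
  also have "\<dots> \<le> (\<integral>\<^sup>+\<omega>. Y \<omega> \<partial>M) + ennreal b * (\<integral>\<^sup>+\<omega>. Y \<omega> * ennreal (thr i \<omega>) \<partial>M)"
    by (intro add_left_mono mult_left_mono nn_integral_indicator_le[OF p YF valid r finY]) auto
  also have "\<dots> = (\<integral>\<^sup>+\<omega>. Y \<omega> + ennreal b * (Y \<omega> * ennreal (thr i \<omega>)) \<partial>M)"
    by (simp add: nn_integral_add nn_integral_cmult)
  also have "\<dots> \<le> (\<integral>\<^sup>+\<omega>. Z \<omega> \<partial>M)"
  proof (rule nn_integral_mono)
    fix \<omega> assume \<omega>: "\<omega> \<in> space M"
    have nn: "0 \<le> b * thr i \<omega>" using b r(2)[OF \<omega>] by simp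
    have "exp (- (b * thr i \<omega>)) * (1 + b * thr i \<omega>) \<le> exp (- (b * thr i \<omega>)) * exp (b * thr i \<omega>)"
      by (intro mult_left_mono exp_ge_add_one_self) auto
    also have "\<dots> = 1" by (simp add: exp_minus)
    finally have "ennreal (exp (- (b * thr i \<omega>)) * (1 + b * thr i \<omega>)) \<le> 1"
      by simp
    then have "Z \<omega> * ennreal (exp (- (b * thr i \<omega>)) * (1 + b * thr i \<omega>)) \<le> Z \<omega> * 1"
      by (intro mult_left_mono) auto
    moreover have "ennreal (exp (- (b * thr i \<omega>)) * (1 + b * thr i \<omega>))
        = ennreal (exp (- (b * thr i \<omega>))) * (1 + ennreal b * ennreal (thr i \<omega>))"
      using b r(2)[OF \<omega>] nn by (simp add: ennreal_mult ennreal_plus)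
    ultimately show "Y \<omega> + ennreal b * (Y \<omega> * ennreal (thr i \<omega>)) \<le> Z \<omega>"
      by (simp add: Y_def distrib_left mult_ac)
  qed
  finally show ?thesis .
qed

text \<open>Ville's inequality. The induction tracks the process stopped when it first reaches \<open>K\<close>.\<close>

lemma nn_supermartingale_maximal_inequality:
  fixes X :: "nat \<Rightarrow> 'w \<Rightarrow> ennreal"
  assumes sub: "\<And>t. subalgebra M (F t)" and mono: "\<And>s t. s \<le> t \<Longrightarrow> sets (F s) \<subseteq> sets (F t)"
    and X: "\<And>t. X t \<in> borel_measurable (F t)"
    and super: "\<And>t B. B \<in> sets (F t) \<Longrightarrow>
      (\<integral>\<^sup>+\<omega>. X (Suc t) \<omega> * indicator B \<omega> \<partial>M) \<le> (\<integral>\<^sup>+\<omega>. X t \<omega> * indicator B \<omega> \<partial>M)"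
  shows "K * emeasure M {\<omega> \<in> space M. \<exists>t. K \<le> X t \<omega>} \<le> (\<integral>\<^sup>+\<omega>. X 0 \<omega> \<partial>M)"
proof -
  have spF: "space (F t) = space M" for t using sub[of t] by (simp add: subalgebra_def)
  have XM [measurable]: "X t \<in> borel_measurable M" for t
    using measurable_from_subalg[OF sub X] .
  have XF: "X s \<in> borel_measurable (F t)" if "s \<le> t" for s t
  proof (rule measurable_from_subalg[OF _ X])
    show "subalgebra (F t) (F s)"
      using mono[OF that] by (simp add: subalgebra_def spF)
  qed
  \<comment> \<open>The event that \<open>K\<close> has not been reached by time \<open>t\<close>;
    it is decided by \<open>F t\<close>.\<close>
  define N where "N t = {\<omega> \<in> space M. \<forall>s\<le>t. X s \<omega> < K}" for t
  have NF: "N t \<in> sets (F t)" for t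
  proof -
    have "N t = {\<omega> \<in> space (F t). \<forall>s\<in>{..t}. X s \<omega> < K}"
      by (auto simp: N_def spF)
    also have "\<dots> \<in> sets (F t)"
      by (intro sets.sets_Collect_finite_All borel_measurable_less XF) auto
    finally show ?thesis .
  qed
  have NM [measurable]: "N t \<in> sets M" for t
    using NF[of t] sub[of t] by (auto simp: subalgebra_def)
  have stopped: "K * emeasure M (space M - N t) + (\<integral>\<^sup>+\<omega>. X t \<omega> * indicator (N t) \<omega> \<partial>M)
      \<le> (\<integral>\<^sup>+\<omega>. X 0 \<omega> \<partial>M)" for t
  proof (induction t)
    case 0
    have "K * emeasure M (space M - N 0) + (\<integral>\<^sup>+\<omega>. X 0 \<omega> * indicator (N 0) \<omega> \<partial>M)
        = (\<integral>\<^sup>+\<omega>. K * indicator (space M - N 0) \<omega> + X 0 \<omega> * indicator (N 0) \<omega> \<partial>M)"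
      by (simp add: nn_integral_add nn_integral_cmult)
    also have "\<dots> \<le> (\<integral>\<^sup>+\<omega>. X 0 \<omega> \<partial>M)"
      by (intro nn_integral_mono) (auto simp: N_def indicator_def not_less)
    finally show ?case .
  next
    case (Suc t)
    let ?D = "N t - N (Suc t)"
    have Nsub: "N (Suc t) \<subseteq> N t" "N t \<subseteq> space M" by (auto simp: N_def)
    have "emeasure M (space M - N (Suc t)) = emeasure M (space M - N t) + emeasure M ?D"
      using Nsub by (subst plus_emeasure) (auto intro: arg_cong[where f = "emeasure M"])
    then have "K * emeasure M (space M - N (Suc t)) + (\<integral>\<^sup>+\<omega>. X (Suc t) \<omega> * indicator (N (Suc t)) \<omega> \<partial>M)
        = K * emeasure M (space M - N t)
          + (\<integral>\<^sup>+\<omega>. K * indicator ?D \<omega> + X (Suc t) \<omega> * indicator (N (Suc t)) \<omega> \<partial>M)"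
      by (simp add: nn_integral_add nn_integral_cmult distrib_left add.assoc)
    \<comment> \<open>On \<open>?D\<close> the level is first reached at \<open>Suc t\<close>, so
      \<open>K\<close> is at most \<open>X (Suc t)\<close> there.\<close>
    also have "\<dots> \<le> K * emeasure M (space M - N t) + (\<integral>\<^sup>+\<omega>. X (Suc t) \<omega> * indicator (N t) \<omega> \<partial>M)"
      by (intro add_left_mono nn_integral_mono)
        (auto simp: N_def indicator_def not_less le_Suc_eq)
    also have "\<dots> \<le> K * emeasure M (space M - N t) + (\<integral>\<^sup>+\<omega>. X t \<omega> * indicator (N t) \<omega> \<partial>M)"
      by (intro add_left_mono super NF)
    also have "\<dots> \<le> (\<integral>\<^sup>+\<omega>. X 0 \<omega> \<partial>M)" by (rule Suc.IH)
    finally show ?case .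
  qed
  have "{\<omega> \<in> space M. \<exists>t. K \<le> X t \<omega>} = (\<Union>t. space M - N t)"
    unfolding N_def not_less[symmetric] by blast
  moreover have "incseq (\<lambda>t. space M - N t)"
    by (auto simp: incseq_def N_def)
  ultimately have "K * emeasure M {\<omega> \<in> space M. \<exists>t. K \<le> X t \<omega>}
      = (SUP t. K * emeasure M (space M - N t))"
    by (simp only: SUP_mult_left_ennreal[symmetric])
      (subst SUP_emeasure_incseq, auto)
  also have "\<dots> \<le> (\<integral>\<^sup>+\<omega>. X 0 \<omega> \<partial>M)"
  proof (rule SUP_least)
    fix t
    show "K * emeasure M (space M - N t) \<le> (\<integral>\<^sup>+\<omega>. X 0 \<omega> \<partial>M)"
      using stopped[of t] by (rule order_trans[rotated]) simp
  qed
  finally show ?thesis .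
qed

text \<open>An \<open>ennreal\<close> series can be integrated term by term and is measurable
  without summability conditions.\<close>

lemma (in online_path) ennreal_mix:
  assumes "finite B" "B \<subseteq> {1..}"
  shows "ennreal (mix B) =
    (\<Sum>n. ennreal (weight (Suc n)) * (\<Prod>i\<in>B. ennreal (E_os \<alpha> P thr (Suc n) i \<omega>)))"
proof -
  let ?f = "\<lambda>a. weight a * (\<Prod>i\<in>B. E_os \<alpha> P thr a i \<omega>)"
  have nn: "0 \<le> ?f a" for a by (simp add: weight_nonneg prod_nonneg E_os_def)
  have "(?f has_sum mix B) {1..}"
    unfolding mixture_def by (intro has_sum_infsum mix_summable assms)
  moreover have "{1..} = Suc ` UNIV"
    by (auto simp: image_iff Suc_le_eq gr0_conv_Suc)
  ultimately have "((?f \<circ> Suc) has_sum mix B) UNIV"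
    by (subst has_sum_reindex[symmetric]) auto
  then have "(\<lambda>n. ?f (Suc n)) sums mix B"
    by (auto simp: o_def dest: has_sum_imp_sums)
  then have "ennreal (mix B) = (\<Sum>n. ennreal (?f (Suc n)))"
    using nn by (subst suminf_ennreal2) (auto simp: sums_iff)
  also have "(\<lambda>n. ennreal (?f (Suc n)))
      = (\<lambda>n. ennreal (weight (Suc n)) * (\<Prod>i\<in>B. ennreal (E_os \<alpha> P thr (Suc n) i \<omega>)))"
    by (intro ext, subst ennreal_mult) (auto simp: weight_nonneg prod_nonneg E_os_def prod_ennreal)
  finally show ?thesis .
qed

subsection \<open>Measurability\<close>

lemma pred_le_countable:
  fixes f g :: "'w \<Rightarrow> 'b::{countable, linorder}"
  assumes "f \<in> measurable A (count_space UNIV)" "g \<in> measurable A (count_space UNIV)"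
  shows "Measurable.pred A (\<lambda>\<omega>. f \<omega> \<le> g \<omega>)"
proof -
  have "Measurable.pred A (\<lambda>\<omega>. f \<omega> \<le> k)" for k
    using measurable_compose[OF assms(1), of "\<lambda>x. x \<le> k"] by simp
  then show ?thesis
    by (rule measurable_compose_countable[OF _ assms(2)])
qed

lemma measurable_count_spaceI_le:
  fixes f :: "'w \<Rightarrow> int"
  assumes "\<And>k. Measurable.pred A (\<lambda>\<omega>. f \<omega> \<le> k)"
  shows "f \<in> measurable A (count_space UNIV)"
proof (subst measurable_count_space_eq_countable, safe)
  fix k
  have "f -` {k} \<inter> space A = {\<omega> \<in> space A. f \<omega> \<le> k \<and> \<not> f \<omega> \<le> k - 1}" by auto
  also have "\<dots> \<in> sets A"
    using assms[of k] assms[of "k - 1"] by measurable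
  finally show "f -` {k} \<inter> space A \<in> sets A" .
qed simp_all

text \<open>No distribution is fixed: measurability with respect to \<open>A\<close> transfers to
  every \<open>M\<close> with \<open>sets M = sets A\<close>.\<close>

locale online_model =
  fixes A :: "'w measure" and F :: "nat \<Rightarrow> 'w measure"
    and P thr :: "nat \<Rightarrow> 'w \<Rightarrow> real" and \<alpha> :: real
  assumes \<alpha>: "0 < \<alpha>" "\<alpha> < 1"
    and filtr: "filtration (space A) F" and sub: "\<And>i. subalgebra A (F i)"
    and P_adapted: "\<And>i. i \<ge> 1 \<Longrightarrow> P i \<in> borel_measurable (F i)"
    and thr_predictable: "\<And>i. i \<ge> 1 \<Longrightarrow> thr i \<in> borel_measurable (F (i - 1))"
    and thr_nonneg: "\<And>i \<omega>. i \<ge> 1 \<Longrightarrow> \<omega> \<in> space A \<Longrightarrow> 0 \<le> thr i \<omega>"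
begin

lemma path: "\<omega> \<in> space A \<Longrightarrow> online_path \<alpha> thr \<omega>"
  by standard (use \<alpha> thr_nonneg in auto)

lemma space_F: "space (F i) = space A"
  using sub[of i] by (simp add: subalgebra_def)

lemma measurable_F_mono: "f \<in> measurable (F s) N \<Longrightarrow> s \<le> t \<Longrightarrow> f \<in> measurable (F t) N"
  using filtration.sets_F_mono[OF filtr, of s t]
  by (intro measurable_from_subalg[of "F t" "F s"]) (auto simp: subalgebra_def space_F)

lemma measurable_F: "f \<in> measurable (F s) N \<Longrightarrow> f \<in> measurable A N"
  by (rule measurable_from_subalg[OF sub])

lemma P_measurable_F: "1 \<le> i \<Longrightarrow> i \<le> t \<Longrightarrow> P i \<in> borel_measurable (F t)"
  using measurable_F_mono[OF P_adapted] .

lemma thr_measurable_F: "1 \<le> i \<Longrightarrow> i \<le> t \<Longrightarrow> thr i \<in> borel_measurable (F t)"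
  using measurable_F_mono[OF thr_predictable] by simp

lemma P_measurable: "1 \<le> i \<Longrightarrow> P i \<in> borel_measurable A"
  by (rule measurable_F[OF P_adapted])

lemma thr_measurable: "1 \<le> i \<Longrightarrow> thr i \<in> borel_measurable A"
  by (rule measurable_F[OF thr_predictable])

lemma E_os_measurable_F: "1 \<le> i \<Longrightarrow> i \<le> t \<Longrightarrow> E_os \<alpha> P thr a i \<in> borel_measurable (F t)"
  unfolding E_os_def[abs_def] using P_measurable_F thr_measurable_F by measurable

lemma prod_E_os_measurable_F:
  "B \<subseteq> {1..t} \<Longrightarrow> (\<lambda>\<omega>. \<Prod>i\<in>B. ennreal (E_os \<alpha> P thr a i \<omega>)) \<in> borel_measurable (F t)"
  using E_os_measurable_F by (intro borel_measurable_prod_ennreal measurable_ennreal) auto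

text \<open>Measurability is proved for the \<open>ennreal\<close> series; it agrees with the real
  mixture on \<open>space A\<close>, where the path results apply.\<close>

lemma mixture_measurable:
  assumes "B \<subseteq> {1..}" "finite B"
  shows "mixture \<alpha> P thr B \<in> borel_measurable A"
proof -
  obtain t where "B \<subseteq> {1..t}"
  proof
    show "B \<subseteq> {1..Max B}" using assms by auto
  qed
  then have "(\<lambda>\<omega>. \<Sum>n. ennreal (weight (Suc n)) * (\<Prod>i\<in>B. ennreal (E_os \<alpha> P thr (Suc n) i \<omega>)))
      \<in> borel_measurable (F t)"
    by (intro borel_measurable_suminf_order borel_measurable_times_ennreal prod_E_os_measurable_F) auto
  from measurable_F[OF this]
  have "(\<lambda>\<omega>. enn2real (\<Sum>n. ennreal (weight (Suc n)) * (\<Prod>i\<in>B. ennreal (E_os \<alpha> P thr (Suc n) i \<omega>))))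
      \<in> borel_measurable A"
    by measurable
  moreover have "mixture \<alpha> P thr B \<omega>
      = enn2real (\<Sum>n. ennreal (weight (Suc n)) * (\<Prod>i\<in>B. ennreal (E_os \<alpha> P thr (Suc n) i \<omega>)))"
    if "\<omega> \<in> space A" for \<omega>
  proof -
    have "0 \<le> mixture \<alpha> P thr B \<omega>"
      unfolding mixture_def
      by (intro infsum_nonneg) (simp add: weight_nonneg prod_nonneg E_os_def)
    then show ?thesis
      using online_path.ennreal_mix[OF path[OF that] assms(2,1)] by (metis enn2real_ennreal)
  qed
  ultimately show ?thesis by (simp cong: measurable_cong)
qed

lemma rejected_measurable:
  "rejected P thr t \<in> measurable A (count_space (Pow {1..t}))"
proof (subst measurable_count_space_eq2, safe)
  show "x \<in> {1..t}" if "x \<in> rejected P thr t \<omega>" for x \<omega>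
    using that rejected_subset[of P thr t \<omega>] by blast
  fix B assume B: "B \<subseteq> {1..t}"
  have "rejected P thr t -` {B} \<inter> space A = {\<omega> \<in> space A. \<forall>i\<in>{1..t}. (P i \<omega> \<le> thr i \<omega>) = (i \<in> B)}"
    unfolding rejected_def using B by blast
  also have "\<dots> \<in> sets A"
  proof (intro sets.sets_Collect_finite_All)
    fix i assume "i \<in> {1..t}"
    then have [measurable]: "P i \<in> borel_measurable A" "thr i \<in> borel_measurable A"
      using P_measurable thr_measurable by auto
    show "{\<omega> \<in> space A. (P i \<omega> \<le> thr i \<omega>) = (i \<in> B)} \<in> sets A" by measurable
  qed simp
  finally show "rejected P thr t -` {B} \<inter> space A \<in> sets A" .
qed

lemma rejected_fun_measurable:
  "(\<lambda>\<omega>. f (rejected P thr t \<omega>)) \<in> measurable A (count_space UNIV)"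
  by (rule measurable_compose[OF rejected_measurable]) simp

lemma test_os_measurable:
  assumes "I \<subseteq> {1..}" "finite I"
  shows "Measurable.pred A (\<lambda>\<omega>. test_os \<alpha> P thr a \<omega> I = 0)"
proof -
  have "(\<lambda>\<omega>. wealth \<alpha> P thr a I t \<omega>) \<in> borel_measurable A" for t
    unfolding wealth_def
    by (intro borel_measurable_prod measurable_F[OF E_os_measurable_F[OF _ order_refl]]) auto
  then have "Measurable.pred A (\<lambda>\<omega>. \<forall>t\<in>I. \<not> wealth \<alpha> P thr a I t \<omega> \<ge> 1 / level \<alpha> a)"
    using assms(2) by measurable
  moreover have "(test_os \<alpha> P thr a \<omega> I = 0) = (\<forall>t\<in>I. \<not> wealth \<alpha> P thr a I t \<omega> \<ge> 1 / level \<alpha> a)" for \<omega>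
    by (simp add: test_os_def)
  ultimately show ?thesis by simp
qed

text \<open>By \<open>closed_bound_le_iff\<close> the event is a countable intersection over
  \<open>a\<close> of finite unions over \<open>I\<close>.\<close>

lemma cu_measurable: "(\<lambda>\<omega>. int (cu_online_simple \<alpha> P thr t \<omega>)) \<in> measurable A (count_space UNIV)"
proof (rule measurable_count_spaceI_le)
  fix k :: int
  show "Measurable.pred A (\<lambda>\<omega>. int (cu_online_simple \<alpha> P thr t \<omega>) \<le> k)"
  proof (cases "0 \<le> k")
    case False
    then have "(\<lambda>\<omega>. int (cu_online_simple \<alpha> P thr t \<omega>) \<le> k) = (\<lambda>_. False)" by auto
    then show ?thesis by simp
  next
    case True
    have eq: "int (cu_online_simple \<alpha> P thr t \<omega>) \<le> k \<longleftrightarrow>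
        (\<forall>a\<in>{1..}. \<exists>I\<in>Pow {1..t}. test_os \<alpha> P thr a \<omega> I = 0 \<and> card (rejected P thr t \<omega> - I) \<le> nat k)"
      if "\<omega> \<in> space A" for \<omega>
    proof -
      interpret online_path \<alpha> P thr \<omega> by (rule path[OF that])
      have "int (cu_online_simple \<alpha> P thr t \<omega>) \<le> k \<longleftrightarrow> cu_online_simple \<alpha> P thr t \<omega> \<le> nat k"
        using True by linarith
      then show ?thesis
        by (simp only: cu_online_simple_le_iff closed_bound_le_iff) auto
    qed
    have "Measurable.pred A (\<lambda>\<omega>. \<forall>a\<in>{1..}. \<exists>I\<in>Pow {1..t}.
        test_os \<alpha> P thr a \<omega> I = 0 \<and> card (rejected P thr t \<omega> - I) \<le> nat k)"
    proof (intro pred_intros_countable_bounded pred_intros_finite pred_intros_logic)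
      fix a I assume "I \<in> Pow {1..t}"
      then show "Measurable.pred A (\<lambda>\<omega>. test_os \<alpha> P thr a \<omega> I = 0)"
        by (intro test_os_measurable) (auto intro: finite_subset)
      show "Measurable.pred A (\<lambda>\<omega>. card (rejected P thr t \<omega> - I) \<le> nat k)"
        by (rule rejected_fun_measurable)
    qed auto
    then show ?thesis
      using eq by (simp cong: measurable_cong)
  qed
qed

lemma u_measurable: "u_online_simple \<alpha> P thr t \<in> measurable A (count_space UNIV)"
proof (rule measurable_count_spaceI_le)
  fix k :: int
  have "Measurable.pred A (\<lambda>\<omega>. \<forall>a\<in>{1..}. os_bound \<alpha> P thr a t \<omega> \<le> k)"
  proof (intro pred_intros_countable_bounded)
    fix a
    have [measurable]: "P i \<in> borel_measurable A" "thr i \<in> borel_measurable A" if "i \<in> {1..t}" for i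
      using that P_measurable thr_measurable by auto
    have "(\<lambda>\<omega>. - c_const \<alpha> a * real a
        + (\<Sum>i=1..t. of_bool (P i \<omega> \<le> thr i \<omega>) - c_const \<alpha> a * thr i \<omega>)) \<in> borel_measurable A"
      by measurable
    then show "Measurable.pred A (\<lambda>\<omega>. os_bound \<alpha> P thr a t \<omega> \<le> k)"
      unfolding os_bound_def ceiling_le_iff by measurable
  qed
  then show "Measurable.pred A (\<lambda>\<omega>. u_online_simple \<alpha> P thr t \<omega> \<le> k)"
    by (rule measurable_cong[THEN iffD2, rotated])
      (simp only: online_path.u_online_simple_le_iff[OF path] Ball_def atLeast_iff)
qed

lemma smallest_thr_index_measurable:
  assumes "B \<subseteq> {1..}" "finite B"
  shows "smallest_thr_index thr B \<in> measurable A (count_space UNIV)"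
proof -
  have "Measurable.pred A (\<lambda>\<omega>. i \<in> B \<and> (\<forall>j\<in>B. thr i \<omega> \<le> thr j \<omega>))" for i
  proof (cases "i \<in> B")
    case True
    have [measurable]: "thr j \<in> borel_measurable A" if "j \<in> B" for j
      using that assms(1) thr_measurable by auto
    note [measurable] = this[OF True]
    show ?thesis using assms(2) True by measurable
  qed simp
  then show ?thesis
    unfolding smallest_thr_index_def[abs_def] by measurable
qed

text \<open>Restricting to finite exclusion sets makes the state space countable, so one step can be
  treated with the previous state held fixed.\<close>

lemma m_os_state_measurable:
  "m_os_state \<alpha> P thr t \<in> measurable A (count_space (UNIV \<times> {C. finite C}))"
proof (induction t)
  case 0
  have "m_os_state \<alpha> P thr 0 = (\<lambda>_. (0, {}))" by (rule ext) simp
  then show ?case by simp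
next
  case (Suc t)
  let ?I = "UNIV \<times> {C. finite C} :: (nat \<times> nat set) set"
  let ?step = "\<lambda>dC \<omega>. if mixture \<alpha> P thr ({1..Suc t} - snd dC) \<omega> \<ge> 1 / \<alpha>
      then (fst dC + 1, insert (smallest_thr_index thr (rejected P thr (Suc t) \<omega> - snd dC) \<omega>) (snd dC))
      else dC"
  have "(\<lambda>\<omega>. ?step (m_os_state \<alpha> P thr t \<omega>) \<omega>) \<in> measurable A (count_space ?I)"
  proof (rule measurable_compose_countable'[OF _ Suc.IH])
    show "countable ?I"
      using countable_Collect_finite[where 'a = nat] by simp
    fix dC assume dC: "dC \<in> ?I"
    have idx: "(\<lambda>\<omega>. smallest_thr_index thr (rejected P thr (Suc t) \<omega> - snd dC) \<omega>)
        \<in> measurable A (count_space UNIV)"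
    proof (rule measurable_compose_countable'[OF _ rejected_measurable])
      fix R assume "R \<in> Pow {1..Suc t}"
      then show "(\<lambda>\<omega>. smallest_thr_index thr (R - snd dC) \<omega>) \<in> measurable A (count_space UNIV)"
        by (intro smallest_thr_index_measurable) (auto intro: finite_subset)
    qed (simp add: countable_finite)
    have "(\<lambda>\<omega>. (fst dC + 1, insert (smallest_thr_index thr (rejected P thr (Suc t) \<omega> - snd dC) \<omega>) (snd dC)))
        \<in> measurable A (count_space ?I)"
      using dC by (intro measurable_compose[OF idx]) auto
    moreover have "Measurable.pred A (\<lambda>\<omega>. mixture \<alpha> P thr ({1..Suc t} - snd dC) \<omega> \<ge> 1 / \<alpha>)"
    proof -
      have "mixture \<alpha> P thr ({1..Suc t} - snd dC) \<in> borel_measurable A"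
        by (rule mixture_measurable) auto
      then show ?thesis by measurable
    qed
    ultimately show "?step dC \<in> measurable A (count_space ?I)"
      using dC by (intro measurable_If) (auto simp: pred_def)
  qed
  moreover have "m_os_state \<alpha> P thr (Suc t) \<omega> = ?step (m_os_state \<alpha> P thr t \<omega>) \<omega>"
    if "\<omega> \<in> space A" for \<omega>
    using online_path.m_os_state_Suc[OF path[OF that], where P = P] by simp
  ultimately show ?case by (simp cong: measurable_cong)
qed

lemma m_measurable: "(\<lambda>\<omega>. int (m_online_simple \<alpha> P thr t \<omega>)) \<in> measurable A (count_space UNIV)"
  unfolding m_online_simple_def
  by (rule measurable_compose[OF m_os_state_measurable]) simp

end

subsection \<open>Guarantees under one distribution\<close>

text \<open>The set \<open>I\<close> stands for the true nulls of \<open>M\<close>.\<close>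

locale online_distribution = online_model A F P thr \<alpha> + prob_space M
  for A :: "'w measure" and F P thr \<alpha> and M :: "'w measure" +
  fixes I :: "nat set"
  assumes sets_M: "sets M = sets A" and I: "I \<subseteq> {1..}"
    and valid: "\<And>i x. i \<in> I \<Longrightarrow> 0 \<le> x \<Longrightarrow> x \<le> 1 \<Longrightarrow>
      AE \<omega> in M. real_cond_exp M (F (i - 1)) (indicator {\<omega> \<in> space M. P i \<omega> \<le> x}) \<omega> \<le> x"
begin

lemma space_M: "space M = space A"
  using sets_eq_imp_space_eq[OF sets_M] .

lemma measurable_M: "f \<in> measurable A N \<Longrightarrow> f \<in> measurable M N"
  using measurable_cong_sets[OF sets_M refl, of N] by blast

lemma finite_measure_subalgebra_F: "finite_measure_subalgebra M (F t)"
  using sub[of t] by unfold_locales (simp add: subalgebra_def space_M sets_M)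

definition Z :: "nat \<Rightarrow> nat \<Rightarrow> 'w \<Rightarrow> ennreal" where
  "Z a t \<omega> = (\<Prod>i\<in>I \<inter> {1..t}. ennreal (E_os \<alpha> P thr a i \<omega>))"

lemma Z_measurable_F: "Z a t \<in> borel_measurable (F t)"
  unfolding Z_def[abs_def] by (rule prod_E_os_measurable_F) auto

lemma Z_Suc:
  "Z a (Suc t) \<omega> = (if Suc t \<in> I then Z a t \<omega> * ennreal (E_os \<alpha> P thr a (Suc t) \<omega>) else Z a t \<omega>)"
proof -
  have "I \<inter> {1..Suc t} = (if Suc t \<in> I then insert (Suc t) (I \<inter> {1..t}) else I \<inter> {1..t})"
    by (auto simp: le_Suc_eq)
  then show ?thesis by (auto simp: Z_def mult.commute)
qed

lemma nn_integral_E_os_step: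
  assumes "a \<ge> 1" "Suc t \<in> I" "Y \<in> borel_measurable (F t)" "(\<integral>\<^sup>+\<omega>. Y \<omega> \<partial>M) < \<infinity>"
  shows "(\<integral>\<^sup>+\<omega>. Y \<omega> * ennreal (E_os \<alpha> P thr a (Suc t) \<omega>) \<partial>M) \<le> (\<integral>\<^sup>+\<omega>. Y \<omega> \<partial>M)"
proof -
  interpret G: finite_measure_subalgebra M "F t"
    by (rule finite_measure_subalgebra_F)
  show ?thesis
    using assms thr_nonneg valid[OF assms(2)] thr_predictable[of "Suc t"]
    by (intro G.nn_integral_E_os_le \<alpha> measurable_M P_measurable) (auto simp: space_M)
qed

lemma Z_integral_finite: "a \<ge> 1 \<Longrightarrow> (\<integral>\<^sup>+\<omega>. Z a t \<omega> \<partial>M) < \<infinity>"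
proof (induction t)
  case 0
  then show ?case by (simp add: Z_def emeasure_space_1)
next
  case (Suc t)
  then show ?case
    using nn_integral_E_os_step[OF Suc.prems _ Z_measurable_F Suc.IH]
    by (cases "Suc t \<in> I") (auto simp: Z_Suc intro: le_less_trans)
qed

text \<open>Times outside \<open>I\<close> leave the product unchanged; at times in \<open>I\<close>
  the event \<open>B\<close> is absorbed into the weight of the e-variable inequality.\<close>

lemma Z_supermartingale:
  assumes "a \<ge> 1" "B \<in> sets (F t)"
  shows "(\<integral>\<^sup>+\<omega>. Z a (Suc t) \<omega> * indicator B \<omega> \<partial>M) \<le> (\<integral>\<^sup>+\<omega>. Z a t \<omega> * indicator B \<omega> \<partial>M)"
proof (cases "Suc t \<in> I")
  case False
  then show ?thesis by (simp add: Z_Suc)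
next
  case True
  have "(\<integral>\<^sup>+\<omega>. Z a t \<omega> * indicator B \<omega> \<partial>M) \<le> (\<integral>\<^sup>+\<omega>. Z a t \<omega> \<partial>M)"
    by (intro nn_integral_mono) (auto simp: indicator_def)
  then have "(\<integral>\<^sup>+\<omega>. Z a t \<omega> * indicator B \<omega> \<partial>M) < \<infinity>"
    using Z_integral_finite[OF assms(1), of t] by (rule le_less_trans)
  moreover have "(\<lambda>\<omega>. Z a t \<omega> * indicator B \<omega>) \<in> borel_measurable (F t)"
    using Z_measurable_F assms(2) by measurable
  ultimately show ?thesis
    using nn_integral_E_os_step[OF assms(1) True, of "\<lambda>\<omega>. Z a t \<omega> * indicator B \<omega>"] True
    by (simp add: Z_Suc mult_ac)
qed

definition X :: "nat \<Rightarrow> 'w \<Rightarrow> ennreal" where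
  "X t \<omega> = (\<Sum>n. ennreal (weight (Suc n)) * Z (Suc n) t \<omega>)"

lemma X_eq_mixture: "\<omega> \<in> space M \<Longrightarrow> X t \<omega> = ennreal (mixture \<alpha> P thr (I \<inter> {1..t}) \<omega>)"
  unfolding X_def Z_def by (subst online_path.ennreal_mix[OF path]) (auto simp: space_M)

lemma X_measurable_F: "X t \<in> borel_measurable (F t)"
  unfolding X_def[abs_def]
  by (intro borel_measurable_suminf_order borel_measurable_times_ennreal Z_measurable_F) auto

lemma X_supermartingale:
  assumes B: "B \<in> sets (F t)"
  shows "(\<integral>\<^sup>+\<omega>. X (Suc t) \<omega> * indicator B \<omega> \<partial>M) \<le> (\<integral>\<^sup>+\<omega>. X t \<omega> * indicator B \<omega> \<partial>M)"
proof -
  have ZM [measurable]: "Z a s \<in> borel_measurable M" for a s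
    using measurable_M[OF measurable_F[OF Z_measurable_F]] .
  have BM [measurable]: "B \<in> sets M"
    using B sub[of t] by (auto simp: subalgebra_def sets_M)
  have eq: "(\<integral>\<^sup>+\<omega>. X s \<omega> * indicator B \<omega> \<partial>M)
      = (\<Sum>n. ennreal (weight (Suc n)) * (\<integral>\<^sup>+\<omega>. Z (Suc n) s \<omega> * indicator B \<omega> \<partial>M))" for s
  proof -
    have "(\<integral>\<^sup>+\<omega>. X s \<omega> * indicator B \<omega> \<partial>M)
        = (\<integral>\<^sup>+\<omega>. (\<Sum>n. ennreal (weight (Suc n)) * (Z (Suc n) s \<omega> * indicator B \<omega>)) \<partial>M)"
      by (simp add: X_def mult.assoc[symmetric] flip: ennreal_suminf_multc)
    also have "\<dots> = (\<Sum>n. ennreal (weight (Suc n)) * (\<integral>\<^sup>+\<omega>. Z (Suc n) s \<omega> * indicator B \<omega> \<partial>M))"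
      by (subst nn_integral_suminf) (auto intro!: suminf_cong nn_integral_cmult)
    finally show ?thesis .
  qed
  show ?thesis
    unfolding eq by (intro suminf_le summableI mult_left_mono Z_supermartingale B) auto
qed

text \<open>Ville's inequality at level \<open>1 / \<alpha>\<close> with initial value 1. The same
  event \<open>G\<close> serves both procedures.\<close>

lemma mixture_stays_small:
  "\<exists>G \<in> sets M. (\<forall>\<omega>\<in>G. \<forall>t. mixture \<alpha> P thr (I \<inter> {1..t}) \<omega> < 1 / \<alpha>) \<and> prob G \<ge> 1 - \<alpha>"
proof -
  have XM [measurable]: "X t \<in> borel_measurable M" for t
    using measurable_M[OF measurable_F[OF X_measurable_F]] .
  define N where "N = {\<omega> \<in> space M. \<exists>t. ennreal (1 / \<alpha>) \<le> X t \<omega>}"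
  have NM [measurable]: "N \<in> sets M" unfolding N_def by measurable
  have "ennreal (1 / \<alpha>) * emeasure M N \<le> (\<integral>\<^sup>+\<omega>. X 0 \<omega> \<partial>M)"
    unfolding N_def
  proof (rule nn_supermartingale_maximal_inequality)
    show "subalgebra M (F t)" for t
      using sub[of t] by (simp add: subalgebra_def space_M sets_M)
    show "sets (F s) \<subseteq> sets (F t)" if "s \<le> t" for s t
      using filtration.sets_F_mono[OF filtr that] .
  qed (rule X_measurable_F X_supermartingale, assumption?)+
  also have "(\<integral>\<^sup>+\<omega>. X 0 \<omega> \<partial>M) = (\<integral>\<^sup>+\<omega>. 1 \<partial>M)"
  proof (intro nn_integral_cong)
    fix \<omega> assume \<omega>: "\<omega> \<in> space M"
    interpret online_path \<alpha> P thr \<omega> using path \<omega> by (simp add: space_M)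
    show "X 0 \<omega> = 1" using X_eq_mixture[OF \<omega>, of 0] by (simp add: mix_empty)
  qed
  also have "\<dots> = 1" by (simp add: emeasure_space_1)
  finally have "1 / \<alpha> * prob N \<le> 1"
    using \<alpha> by (simp add: emeasure_eq_measure ennreal_mult[symmetric] flip: ennreal_1)
  then have "prob N \<le> \<alpha>" using \<alpha> by (simp add: field_simps)
  moreover have "mixture \<alpha> P thr (I \<inter> {1..t}) \<omega> < 1 / \<alpha>" if "\<omega> \<in> space M - N" for \<omega> t
  proof (rule ccontr)
    assume "\<not> ?thesis"
    then have "ennreal (1 / \<alpha>) \<le> X t \<omega>"
      using that X_eq_mixture[of \<omega> t] by (auto intro: ennreal_leI)
    then show False using that by (auto simp: N_def)
  qed
  ultimately show ?thesis
    by (intro bexI[of _ "space M - N"]) (auto simp: prob_compl)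
qed

text \<open>The target event contains \<open>G\<close>; its measurability must be shown separately,
  as \<open>prob\<close> is 0 on other sets.\<close>

lemma prob_discoveries:
  assumes d: "\<And>t. d t \<in> measurable A (count_space UNIV)"
    and bound: "\<And>t \<omega>. \<omega> \<in> space A \<Longrightarrow> (\<And>s. mixture \<alpha> P thr (I \<inter> {1..s}) \<omega> < 1 / \<alpha>) \<Longrightarrow>
      d t \<omega> \<le> int (card (rejected P thr t \<omega> - I))"
  shows "prob {\<omega> \<in> space M. \<forall>t\<ge>1. d t \<omega> \<le> int (card (rejected P thr t \<omega> \<inter> ({1..} - I)))} \<ge> 1 - \<alpha>"
proof -
  obtain G where G: "G \<in> sets M" "prob G \<ge> 1 - \<alpha>"
    and small: "\<And>\<omega> t. \<omega> \<in> G \<Longrightarrow> mixture \<alpha> P thr (I \<inter> {1..t}) \<omega> < 1 / \<alpha>"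
    using mixture_stays_small by blast
  let ?D = "{\<omega> \<in> space M. \<forall>t\<in>{1..}. d t \<omega> \<le> int (card (rejected P thr t \<omega> \<inter> ({1..} - I)))}"
  have "Measurable.pred A (\<lambda>\<omega>. d t \<omega> \<le> int (card (rejected P thr t \<omega> \<inter> ({1..} - I))))" for t
    by (intro pred_le_countable d rejected_fun_measurable)
  then have "Measurable.pred M (\<lambda>\<omega>. d t \<omega> \<le> int (card (rejected P thr t \<omega> \<inter> ({1..} - I))))" for t
    by (rule measurable_M)
  then have "Measurable.pred M (\<lambda>\<omega>. \<forall>t\<in>{1..}. d t \<omega> \<le> int (card (rejected P thr t \<omega> \<inter> ({1..} - I))))"
    by (intro pred_intros_countable_bounded) auto
  then have "?D \<in> sets M" by (simp add: pred_def)
  moreover have "G \<subseteq> ?D"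
  proof
    fix \<omega> assume "\<omega> \<in> G"
    then have \<omega>: "\<omega> \<in> space M" using sets.sets_into_space[OF G(1)] by blast
    have "rejected P thr t \<omega> \<inter> ({1..} - I) = rejected P thr t \<omega> - I" for t
      by (auto simp: mem_rejected)
    then show "\<omega> \<in> ?D"
      using bound[of \<omega>] small[OF \<open>\<omega> \<in> G\<close>] \<omega> by (simp add: space_M)
  qed
  ultimately have "prob G \<le> prob ?D" by (intro finite_measure_mono) auto
  then have "1 - \<alpha> \<le> prob ?D" using G(2) by linarith
  then show ?thesis by (simp only: Ball_def atLeast_iff)
qed

text \<open>Otherwise \<open>P 1 \<le> thr 1 < 1\<close> almost surely, and validity of the first
  p-value would give \<open>1 \<le> E[thr 1] < 1\<close>.\<close>

lemma prob_u_less: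
  assumes "1 \<in> I" and d: "d \<in> measurable A (count_space UNIV)" and nonneg: "\<And>\<omega>. 0 \<le> d \<omega>"
  shows "prob {\<omega> \<in> space M. d \<omega> > u_online_simple \<alpha> P thr 1 \<omega>} > 0"
proof (rule ccontr)
  let ?D = "{\<omega> \<in> space M. d \<omega> > u_online_simple \<alpha> P thr 1 \<omega>}"
  assume "\<not> prob ?D > 0"
  then have 0: "emeasure M ?D = 0"
    using zero_less_measure_iff[of M ?D] by (simp add: emeasure_eq_measure)
  have "Measurable.pred M (\<lambda>\<omega>. \<not> d \<omega> \<le> u_online_simple \<alpha> P thr 1 \<omega>)"
    by (intro pred_intros_logic measurable_M pred_le_countable d u_measurable)
  then have D: "?D \<in> sets M" by (simp add: pred_def not_le)
  have "AE \<omega> in M. \<omega> \<notin> ?D"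
    using D 0 by (intro AE_not_in) (auto simp: null_sets_def)
  then have AE: "AE \<omega> in M. P 1 \<omega> \<le> thr 1 \<omega> \<and> thr 1 \<omega> < 1"
  proof (rule AE_mp, intro AE_I2 impI)
    fix \<omega> assume \<omega>: "\<omega> \<in> space M" "\<omega> \<notin> ?D"
    then have "\<not> u_online_simple \<alpha> P thr 1 \<omega> < 0"
      using nonneg[of \<omega>] by auto
    then show "P 1 \<omega> \<le> thr 1 \<omega> \<and> thr 1 \<omega> < 1"
      using online_path.u_online_simple_1_neg[OF path, of \<omega> P] \<omega> by (force simp: space_M)
  qed
  interpret G: finite_measure_subalgebra M "F 0"
    by (rule finite_measure_subalgebra_F)
  have [measurable]: "P 1 \<in> borel_measurable M" "thr 1 \<in> borel_measurable M"
    using P_measurable[of 1] thr_measurable[of 1] measurable_M by auto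
  have "1 = (\<integral>\<^sup>+\<omega>. 1 \<partial>M)" by (simp add: emeasure_space_1)
  also have "\<dots> = (\<integral>\<^sup>+\<omega>. 1 * indicator {\<omega> \<in> space M. P 1 \<omega> \<le> thr 1 \<omega>} \<omega> \<partial>M)"
    using AE by (intro nn_integral_cong_AE) (auto simp: indicator_def)
  also have "\<dots> \<le> (\<integral>\<^sup>+\<omega>. 1 * ennreal (thr 1 \<omega>) \<partial>M)"
    using valid[OF assms(1)] thr_predictable[of 1] thr_nonneg[of 1]
      emeasure_space_1 \<open>P 1 \<in> borel_measurable M\<close>
    by (intro G.nn_integral_indicator_le) (auto simp: space_M)
  also have "\<dots> < (\<integral>\<^sup>+\<omega>. 1 \<partial>M)"
  proof (rule nn_integral_less)
    have le: "AE \<omega> in M. 1 * ennreal (thr 1 \<omega>) \<le> 1"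
      using AE by eventually_elim simp
    then show "AE \<omega> in M. 1 * ennreal (thr 1 \<omega>) \<le> 1" .
    have "(\<integral>\<^sup>+\<omega>. 1 * ennreal (thr 1 \<omega>) \<partial>M) \<le> (\<integral>\<^sup>+\<omega>. 1 \<partial>M)"
      by (rule nn_integral_mono_AE[OF le])
    then show "(\<integral>\<^sup>+\<omega>. 1 * ennreal (thr 1 \<omega>) \<partial>M) \<noteq> \<infinity>"
      by (auto simp: emeasure_space_1 top_unique)
    show "\<not> (AE \<omega> in M. 1 \<le> 1 * ennreal (thr 1 \<omega>))"
    proof
      assume "AE \<omega> in M. 1 \<le> 1 * ennreal (thr 1 \<omega>)"
      with AE have "AE \<omega> in M. False" by eventually_elim simp
      then show False by simp
    qed
  qed (use \<open>thr 1 \<in> borel_measurable M\<close> in auto)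
  finally show False by (simp add: emeasure_space_1)
qed

end

text \<open>Strictness is conditional on \<open>H 1 \<noteq> {}\<close> because it is witnessed at
  time 1 under a distribution for which the first hypothesis is a true null.\<close>

theorem propositionS2:
  fixes A :: "'w measure" and F :: "nat \<Rightarrow> 'w measure"
    and \<P> :: "'w measure set" and H :: "nat \<Rightarrow> 'w measure set"
    and P thr :: "nat \<Rightarrow> 'w \<Rightarrow> real" and \<alpha> :: real
  assumes alpha: "0 < \<alpha>" "\<alpha> < 1"
    and filtr: "filtration (space A) F" "\<And>i. subalgebra A (F i)"
    and F0: "sets (F 0) = {{}, space A}"
    and distributions: "\<P> \<subseteq> space (prob_algebra A)"
    and nulls: "\<And>i. i \<ge> 1 \<Longrightarrow> H i \<subseteq> \<P>"
    and P_adapted: "\<And>i. i \<ge> 1 \<Longrightarrow> P i \<in> borel_measurable (F i)"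
    and P_valid: "\<And>i M x. i \<ge> 1 \<Longrightarrow> M \<in> H i \<Longrightarrow> 0 \<le> x \<Longrightarrow> x \<le> 1 \<Longrightarrow>
      AE \<omega> in M. real_cond_exp M (F (i - 1)) (indicator {\<omega> \<in> space M. P i \<omega> \<le> x}) \<omega> \<le> x"
    and thr_predictable: "\<And>i. i \<ge> 1 \<Longrightarrow> thr i \<in> borel_measurable (F (i - 1))"
    and thr_nonneg: "\<And>i \<omega>. i \<ge> 1 \<Longrightarrow> \<omega> \<in> space A \<Longrightarrow> 0 \<le> thr i \<omega>"
  defines "S \<equiv> rejected P thr"
    and "u \<equiv> u_online_simple \<alpha> P thr"
    and "cu \<equiv> (\<lambda>t \<omega>. int (cu_online_simple \<alpha> P thr t \<omega>))"
    and "m \<equiv> (\<lambda>t \<omega>. int (m_online_simple \<alpha> P thr t \<omega>))"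
  shows "true_discovery_guarantee \<alpha> \<P> H S m \<and> true_discovery_guarantee \<alpha> \<P> H S cu \<and>
    dominates (space A) m u \<and> dominates (space A) cu u \<and>
    (H 1 \<noteq> {} \<longrightarrow>
      uniformly_improves (space A) \<P> m u \<and> uniformly_improves (space A) \<P> cu u)"
proof -
  interpret online_model A F P thr \<alpha>
    by (intro online_model.intro alpha filtr P_adapted thr_predictable thr_nonneg)
  have dist: "online_distribution A F P thr \<alpha> M {i \<in> {1..}. M \<in> H i}" if "M \<in> \<P>" for M
  proof -
    have M: "prob_space M" "sets M = sets A"
      using that distributions by (auto simp: space_prob_algebra)
    then show ?thesis
      using P_valid
      by (intro online_distribution.intro online_model_axioms online_distribution_axioms.intro) auto
  qed
  have "true_discovery_guarantee \<alpha> \<P> H S m"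
    unfolding true_discovery_guarantee_def S_def m_def non_nulls_def
  proof
    fix M assume M: "M \<in> \<P>"
    interpret online_distribution A F P thr \<alpha> M "{i \<in> {1..}. M \<in> H i}"
      by (rule dist[OF M])
    show "1 - \<alpha> \<le> prob {\<omega> \<in> space M. \<forall>t\<ge>1. int (m_online_simple \<alpha> P thr t \<omega>)
        \<le> int (card (rejected P thr t \<omega> \<inter> ({1..} - {i \<in> {1..}. M \<in> H i})))}"
      using online_path.m_le_of_mix_less[OF path I]
      by (intro prob_discoveries m_measurable) (simp add: m_online_simple_def)
  qed
  moreover have "true_discovery_guarantee \<alpha> \<P> H S cu"
    unfolding true_discovery_guarantee_def S_def cu_def non_nulls_def
  proof
    fix M assume M: "M \<in> \<P>"
    interpret online_distribution A F P thr \<alpha> M "{i \<in> {1..}. M \<in> H i}"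
      by (rule dist[OF M])
    show "1 - \<alpha> \<le> prob {\<omega> \<in> space M. \<forall>t\<ge>1. int (cu_online_simple \<alpha> P thr t \<omega>)
        \<le> int (card (rejected P thr t \<omega> \<inter> ({1..} - {i \<in> {1..}. M \<in> H i})))}"
      using online_path.cu_le_of_mix_less[OF path I]
      by (intro prob_discoveries cu_measurable) simp
  qed
  moreover have dom: "dominates (space A) m u" "dominates (space A) cu u"
    using online_path.u_le_m[OF path] online_path.u_le_cu[OF path]
    by (auto simp: dominates_def m_def cu_def u_def)
  moreover have "uniformly_improves (space A) \<P> m u \<and> uniformly_improves (space A) \<P> cu u"
    if ne: "H 1 \<noteq> {}"
  proof -
    obtain M where M: "M \<in> H 1" "M \<in> \<P>"
      using ne nulls[of 1] by auto
    interpret online_distribution A F P thr \<alpha> M "{i \<in> {1..}. M \<in> H i}"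
      by (rule dist[OF M(2)])
    have "prob {\<omega> \<in> space M. m 1 \<omega> > u 1 \<omega>} > 0" "prob {\<omega> \<in> space M. cu 1 \<omega> > u 1 \<omega>} > 0"
      unfolding m_def cu_def u_def
      by (intro prob_u_less m_measurable cu_measurable; use M(1) in simp)+
    then show ?thesis
      using dom M(2) unfolding uniformly_improves_def by blast
  qed
  ultimately show ?thesis by blast
qed

end
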